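(* Let $k$ be an infinite field, let $0<r<m\le n$ be integers, and let $\Omega=\bigcup_{j\in[n]}\omega_j\times\{j\}\subset[m]\times[n]$ with $\omega_j\subset[m]$. If $\#\Omega=r(m+n-r)$ and there is a partition $[n]=\bigcup_{\ell\in[r]}\mathcal{J}_\ell$ such that $\Omega_{\mathcal{J}_\ell}$ is a relaxed $(1,r,m)$-SLMF for every $\ell\in[r]$, then $\Omega$ is a base of the algebraic matroid of $\mathrm{M}(r,m\times n)$.
   Context: Notation: $[s]=\{1,\dots,s\}$; $\#$ denotes cardinality. $Z=(z_{ij})_{(i,j)\in[m]\times[n]}$ is an $m\times n$ matrix of independent variables over $k$, $k[Z]$ is the polynomial ring in these variables, and $I_{r+1}(Z)$ is the (prime) ideal generated by all $(r+1)\times(r+1)$ minors of $Z$. The determinantal variety is $\mathrm{M}(r,m\times n)=\operatorname{Spec}k[Z]/I_{r+1}(Z)$, an integral scheme of dimension $r(m+n-r)$. Algebraic matroid of $\mathrm{M}(r,m\times n)$: its ground set is $[m]\times[n]$; a subset $\Omega\subset[m]\times[n]$ is independent if the images in $k[Z]/I_{r+1}(Z)$ of the $z_{ij}$ with $(i,j)\in\Omega$ are algebraically independent over $k$. A base (or base set) is a maximal independent set; every base has cardinality $r(m+n-r)$. For $\mathcal{J}\subset[n]$ put $\Omega_{\mathcal{J}}=\bigcup_{j\in\mathcal{J}}\omega_j\times\{j\}$. For a positive integer $\nu$, $\Omega_{\mathcal{J}}$ is called a relaxed $(\nu,r,m)$-SLMF if $$\sum_{j\in\mathcal{J}}\max\{\#(\omega_j\cap\mathcal{I})-r,\,0\}\le\nu(\#\mathcal{I}-r)$$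 for every $\mathcal{I}\subset[m]$ with $\#\mathcal{I}\ge r+1$, with equality for $\mathcal{I}=[m]$. *)

theory Defs
  imports
    "HOL-Library.Poly_Mapping"
    "HOL-Library.Disjoint_Sets"
    "HOL-Algebra.QuotRing"
    "Jordan_Normal_Form.Determinant"
    "Jordan_Normal_Form.DL_Submatrix"
begin

text \<open>
  Index sets are 0-based throughout: \<open>[s]\<close> is rendered as \<open>{..<s}\<close>.
\<close>

type_synonym ('v, 'k) mpoly = "('v \<Rightarrow>\<^sub>0 nat) \<Rightarrow>\<^sub>0 'k"

definition Var :: "'v \<Rightarrow> ('v, 'k::comm_ring_1) mpoly" where
  "Var v = Poly_Mapping.single (Poly_Mapping.single v 1) 1"

definition Const :: "'k::comm_ring_1 \<Rightarrow> ('v, 'k) mpoly" where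
  "Const c = Poly_Mapping.single 0 c"

definition vars :: "('v, 'k::comm_ring_1) mpoly \<Rightarrow> 'v set" where
  "vars p = (\<Union>\<mu>\<in>Poly_Mapping.keys p. Poly_Mapping.keys \<mu>)"

definition poly_ring :: "'v set \<Rightarrow> ('v, 'k::comm_ring_1) mpoly ring" where
  "poly_ring V = \<lparr>carrier = {p. vars p \<subseteq> V}, monoid.mult = (*), one = 1, zero = 0, add = (+)\<rparr>"

text \<open>
  The value of \<open>p\<close> at the family \<open>x\<close> of elements of the commutative ring \<open>R\<close>, where \<open>R\<close> is an
  algebra over the coefficients through \<open>\<phi>\<close>.
\<close>

definition poly_eval ::
    "('r, 'b) ring_scheme \<Rightarrow> ('k \<Rightarrow> 'r) \<Rightarrow> ('v \<Rightarrow> 'r) \<Rightarrow> ('v, 'k::comm_ring_1) mpoly \<Rightarrow> 'r" where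
  "poly_eval R \<phi> x p =
     (\<Oplus>\<^bsub>R\<^esub>\<mu>\<in>Poly_Mapping.keys p. \<phi> (Poly_Mapping.lookup p \<mu>) \<otimes>\<^bsub>R\<^esub>
        (\<Otimes>\<^bsub>R\<^esub>v\<in>Poly_Mapping.keys \<mu>. x v [^]\<^bsub>R\<^esub> Poly_Mapping.lookup \<mu> v))"

definition alg_indep ::
    "('r, 'b) ring_scheme \<Rightarrow> ('k::comm_ring_1 \<Rightarrow> 'r) \<Rightarrow> ('v \<Rightarrow> 'r) \<Rightarrow> 'v set \<Rightarrow> bool" where
  "alg_indep R \<phi> x S \<longleftrightarrow>
     (\<forall>p :: ('v, 'k) mpoly. vars p \<subseteq> S \<longrightarrow> poly_eval R \<phi> x p = \<zero>\<^bsub>R\<^esub> \<longrightarrow> p = 0)"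

definition generic_matrix :: "nat \<Rightarrow> nat \<Rightarrow> (nat \<times> nat, 'k::comm_ring_1) mpoly mat" where
  "generic_matrix m n = mat m n Var"

definition generic_minors :: "nat \<Rightarrow> nat \<Rightarrow> nat \<Rightarrow> (nat \<times> nat, 'k::comm_ring_1) mpoly set" where
  "generic_minors s m n =
     {det (submatrix (generic_matrix m n) A B) | A B.
        A \<subseteq> {..<m} \<and> B \<subseteq> {..<n} \<and> card A = s \<and> card B = s}"

definition det_ideal :: "nat \<Rightarrow> nat \<Rightarrow> nat \<Rightarrow> (nat \<times> nat, 'k::comm_ring_1) mpoly set" where
  "det_ideal s m n = Idl\<^bsub>poly_ring ({..<m} \<times> {..<n})\<^esub> (generic_minors s m n)"

text \<open>\<open>k[Z] / I\<^bsub>r+1\<^esub>(Z)\<close>, and the canonical map from \<open>k[Z]\<close> onto it.\<close>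

definition det_coord_ring ::
    "nat \<Rightarrow> nat \<Rightarrow> nat \<Rightarrow> (nat \<times> nat, 'k::comm_ring_1) mpoly set ring" where
  "det_coord_ring r m n = poly_ring ({..<m} \<times> {..<n}) Quot det_ideal (r + 1) m n"

definition det_proj ::
    "nat \<Rightarrow> nat \<Rightarrow> nat \<Rightarrow> (nat \<times> nat, 'k::comm_ring_1) mpoly \<Rightarrow> (nat \<times> nat, 'k) mpoly set" where
  "det_proj r m n p = det_ideal (r + 1) m n +>\<^bsub>poly_ring ({..<m} \<times> {..<n})\<^esub> p"

definition det_matroid_indep ::
    "'k::field itself \<Rightarrow> nat \<Rightarrow> nat \<Rightarrow> nat \<Rightarrow> (nat \<times> nat) set \<Rightarrow> bool" where
  "det_matroid_indep K r m n \<Omega> \<longleftrightarrow>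
     \<Omega> \<subseteq> {..<m} \<times> {..<n} \<and>
     alg_indep (det_coord_ring r m n) (\<lambda>c :: 'k. det_proj r m n (Const c))
       (\<lambda>v. det_proj r m n (Var v)) \<Omega>"

definition det_matroid_base ::
    "'k::field itself \<Rightarrow> nat \<Rightarrow> nat \<Rightarrow> nat \<Rightarrow> (nat \<times> nat) set \<Rightarrow> bool" where
  "det_matroid_base K r m n \<Omega> \<longleftrightarrow>
     det_matroid_indep K r m n \<Omega> \<and>
     (\<forall>\<Omega>'. det_matroid_indep K r m n \<Omega>' \<and> \<Omega> \<subseteq> \<Omega>' \<longrightarrow> \<Omega>' = \<Omega>)"

definition Omega :: "(nat \<Rightarrow> nat set) \<Rightarrow> nat set \<Rightarrow> (nat \<times> nat) set" where
  "Omega \<omega> J = (\<Union>j\<in>J. \<omega> j \<times> {j})"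

text \<open>
  \<open>relaxed_SLMF \<nu> r m \<omega> J\<close> says that \<open>Omega \<omega> J\<close> is a relaxed \<open>(\<nu>, r, m)\<close>-SLMF.
\<close>

definition relaxed_SLMF ::
    "nat \<Rightarrow> nat \<Rightarrow> nat \<Rightarrow> (nat \<Rightarrow> nat set) \<Rightarrow> nat set \<Rightarrow> bool" where
  "relaxed_SLMF \<nu> r m \<omega> J \<longleftrightarrow>
     (\<forall>I \<subseteq> {..<m}. r + 1 \<le> card I \<longrightarrow>
        (\<Sum>j\<in>J. max (int (card (\<omega> j \<inter> I)) - int r) 0) \<le> int \<nu> * (int (card I) - int r)) \<and>
     (\<Sum>j\<in>J. max (int (card (\<omega> j \<inter> {..<m})) - int r) 0) = int \<nu> * (int m - int r)"

end

theory Submission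
  imports Defs "HOL-Library.Product_Lexorder"
begin

text \<open>
  Independence. Elements of \<open>I\<^bsub>r+1\<^esub>(Z)\<close> vanish on all products \<open>A B\<close> with inner dimension \<open>r\<close>, so it
  suffices that \<open>(A, B) \<mapsto> (A B)\<^sub>\<Omega>\<close> is dominant. At the point where column \<open>j \<in> J l\<close> of \<open>B\<close> is the
  \<open>l\<close>-th unit vector, its derivative is onto as soon as, for every \<open>l\<close>, the vectors in the left
  kernel of \<open>A\<close> supported in some \<open>\<omega> j\<close>, \<open>j \<in> J l\<close>, span this kernel. The latter is a nonempty open
  condition on \<open>A\<close>: by Hall's theorem, a generic matrix with \<open>m - r\<close> rows supported in the \<open>\<omega> j\<close> has
  only nonzero maximal minors, and a basis of its kernel can serve as \<open>A\<close>. The \<open>r\<close> open conditions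
  have a common point. The derivative is used only through lowest-degree forms, so the
  characteristic does not matter.

  Maximality. If \<open>\<Omega>'\<close> has more than \<open>r (m + n - r)\<close> elements, then for every \<open>s \<le> r\<close> and every
  \<open>s\<close>-minor \<open>\<delta>\<close>, all \<open>\<delta> z\<^sub>i\<^sub>j\<close> are modulo \<open>I\<^bsub>s+1\<^esub>(Z)\<close> polynomials in the \<open>s (m + n - s)\<close> variables in the
  rows and columns of \<open>\<delta>\<close>; counting monomials gives a nonzero \<open>p\<close> in the variables \<open>\<Omega>'\<close> with
  \<open>\<delta>\<^sup>D p \<in> I\<^bsub>s+1\<^esub>(Z)\<close>. Hence a nonzero polynomial in \<open>\<Omega>'\<close> lying in \<open>I\<^sub>s(Z)\<close> has a power with a nonzero
  multiple in the variables \<open>\<Omega>'\<close> lying in \<open>I\<^bsub>s+1\<^esub>(Z)\<close>, and induction on \<open>s\<close> produces a relation on \<open>\<Omega>'\<close>.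
  This avoids the primality of the determinantal ideals.
\<close>

section \<open>Evaluation of multivariate polynomials\<close>

definition mon_eval :: "('v \<Rightarrow> 'a::comm_ring_1) \<Rightarrow> ('v \<Rightarrow>\<^sub>0 nat) \<Rightarrow> 'a" where
  "mon_eval x \<mu> = (\<Prod>v\<in>Poly_Mapping.keys \<mu>. x v ^ Poly_Mapping.lookup \<mu> v)"

text \<open>Counterpart of \<open>poly_eval\<close> with the target ring given by a type class,
  where univariate polynomials and determinants are available as targets and arguments.\<close>

definition eval_poly ::
    "('k::comm_ring_1 \<Rightarrow> 'a::comm_ring_1) \<Rightarrow> ('v \<Rightarrow> 'a) \<Rightarrow> ('v, 'k) mpoly \<Rightarrow> 'a" where
  "eval_poly h x p = (\<Sum>\<mu>\<in>Poly_Mapping.keys p. h (Poly_Mapping.lookup p \<mu>) * mon_eval x \<mu>)"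

lemma mon_eval_superset:
  assumes "finite S" "Poly_Mapping.keys \<mu> \<subseteq> S"
  shows "mon_eval x \<mu> = (\<Prod>v\<in>S. x v ^ Poly_Mapping.lookup \<mu> v)"
  unfolding mon_eval_def
  by (rule prod.mono_neutral_left) (use assms in \<open>auto simp: in_keys_iff\<close>)

lemma mon_eval_0 [simp]: "mon_eval x 0 = 1"
  by (simp add: mon_eval_def)

lemma mon_eval_single [simp]: "mon_eval x (Poly_Mapping.single v e) = x v ^ e"
  by (subst mon_eval_superset[of "{v}"]) auto

lemma mon_eval_add: "mon_eval x (\<mu> + \<nu>) = mon_eval x \<mu> * mon_eval x \<nu>"
proof -
  let ?S = "Poly_Mapping.keys \<mu> \<union> Poly_Mapping.keys \<nu>"
  have fin: "finite ?S" by simp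
  have sub: "Poly_Mapping.keys (\<mu> + \<nu>) \<subseteq> ?S" by (rule Poly_Mapping.keys_add)
  show ?thesis
    using mon_eval_superset[OF fin sub, of x] mon_eval_superset[OF fin, of \<mu> x]
      mon_eval_superset[OF fin, of \<nu> x]
    by (simp add: lookup_add power_add prod.distrib)
qed

lemma mon_eval_hom:
  assumes "comm_ring_hom g"
  shows "g (mon_eval x \<mu>) = mon_eval (\<lambda>v. g (x v)) \<mu>"
proof -
  interpret comm_ring_hom g by fact
  show ?thesis by (simp add: mon_eval_def hom_prod hom_power)
qed

lemma sum_single_keys:
  "(\<Sum>\<mu>\<in>Poly_Mapping.keys p. Poly_Mapping.single \<mu> (Poly_Mapping.lookup p \<mu>)) = p"
  by (rule poly_mapping_eqI) (simp add: lookup_sum lookup_single when_def in_keys_iff)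

lemma eval_poly_0 [simp]: "eval_poly h x 0 = 0"
  by (simp add: eval_poly_def)

context
  fixes h :: "'k::comm_ring_1 \<Rightarrow> 'a::comm_ring_1"
  assumes h: "comm_ring_hom h"
begin

interpretation comm_ring_hom h by (rule h)

lemma eval_poly_single: "eval_poly h x (Poly_Mapping.single \<mu> c) = h c * mon_eval x \<mu>"
  by (cases "c = 0") (auto simp: eval_poly_def)

lemma eval_poly_add: "eval_poly h x (p + q) = eval_poly h x p + eval_poly h x q"
  unfolding eval_poly_def
  by (rule setsum_keys_plus_distrib) (auto simp: hom_add algebra_simps)

lemma eval_poly_sum: "eval_poly h x (\<Sum>i\<in>I. f i) = (\<Sum>i\<in>I. eval_poly h x (f i))"
  by (induction I rule: infinite_finite_induct) (auto simp: eval_poly_add)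

lemma eval_poly_mult: "eval_poly h x (p * q) = eval_poly h x p * eval_poly h x q"
proof -
  let ?s = "\<lambda>p \<mu>. Poly_Mapping.single \<mu> (Poly_Mapping.lookup p \<mu>)"
  have "p * q = (\<Sum>\<mu>\<in>Poly_Mapping.keys p. ?s p \<mu>) * (\<Sum>\<nu>\<in>Poly_Mapping.keys q. ?s q \<nu>)"
    by (simp only: sum_single_keys)
  also have "\<dots> = (\<Sum>\<mu>\<in>Poly_Mapping.keys p. \<Sum>\<nu>\<in>Poly_Mapping.keys q. ?s p \<mu> * ?s q \<nu>)"
    by (simp add: sum_product)
  finally have "eval_poly h x (p * q) =
      (\<Sum>\<mu>\<in>Poly_Mapping.keys p. \<Sum>\<nu>\<in>Poly_Mapping.keys q.
        (h (Poly_Mapping.lookup p \<mu>) * mon_eval x \<mu>) * (h (Poly_Mapping.lookup q \<nu>) * mon_eval x \<nu>))"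
    by (simp add: eval_poly_sum mult_single eval_poly_single hom_mult mon_eval_add algebra_simps)
  then show ?thesis
    by (simp add: eval_poly_def sum_product)
qed

lemma comm_ring_hom_eval_poly: "comm_ring_hom (eval_poly h x)"
proof
  show "eval_poly h x 1 = 1"
    using eval_poly_single[of x 0 1] by simp
qed (auto simp: eval_poly_add eval_poly_mult)

lemma eval_poly_Const: "eval_poly h x (Const c) = h c"
  by (simp add: Const_def eval_poly_single)

lemma eval_poly_Var: "eval_poly h x (Var v) = x v"
  by (simp add: Var_def eval_poly_single)

end

lemma eval_poly_hom:
  assumes "comm_ring_hom g"
  shows "g (eval_poly h x p) = eval_poly (\<lambda>c. g (h c)) (\<lambda>v. g (x v)) p"
proof -
  interpret comm_ring_hom g by fact
  show ?thesis by (simp add: eval_poly_def hom_sum hom_mult mon_eval_hom[OF assms])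
qed

lemma comm_ring_hom_id: "comm_ring_hom (\<lambda>c::'k::comm_ring_1. c)"
  by unfold_locales auto

abbreviation eval_at :: "('v \<Rightarrow> 'k::comm_ring_1) \<Rightarrow> ('v, 'k) mpoly \<Rightarrow> 'k" where
  "eval_at \<equiv> eval_poly (\<lambda>c. c)"

lemma mon_eval_Var: "mon_eval Var \<mu> = Poly_Mapping.single \<mu> (1 :: 'k::comm_ring_1)"
proof -
  have pw: "(Var v :: ('v, 'k) mpoly) ^ e = Poly_Mapping.single (Poly_Mapping.single v e) 1" for v e
    by (induction e) (auto simp: Var_def mult_single simp flip: single_add)
  have pr: "(\<Prod>v\<in>S. Poly_Mapping.single (f v) 1 :: ('v, 'k) mpoly) = Poly_Mapping.single (\<Sum>v\<in>S. f v) 1"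
    if "finite S" for S and f :: "'v \<Rightarrow> 'v \<Rightarrow>\<^sub>0 nat"
    using that by (induction S rule: finite_induct) (auto simp: mult_single)
  show ?thesis
    by (simp add: mon_eval_def pw pr sum_single_keys)
qed

text \<open>Presents \<open>p\<close> as an expression in constants and variables, so that a
  homomorphism out of the polynomial ring can be computed from its values on these.\<close>

lemma eval_poly_Const_Var: "eval_poly Const Var p = p"
proof -
  have "eval_poly Const Var p =
      (\<Sum>\<mu>\<in>Poly_Mapping.keys p. Poly_Mapping.single \<mu> (Poly_Mapping.lookup p \<mu>))"
    by (simp add: eval_poly_def mon_eval_Var Const_def mult_single)
  then show ?thesis by (simp only: sum_single_keys)
qed

section \<open>Polynomials over an infinite field\<close>

lemma poly_eq_0_infinite:
  fixes P :: "'k::field poly"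
  assumes "infinite (UNIV :: 'k set)" "\<And>t. poly P t = 0"
  shows "P = 0"
proof (rule ccontr)
  assume "P \<noteq> 0"
  then have "finite {t. poly P t = 0}" by (rule poly_roots_finite)
  then show False using assms by simp
qed

text \<open>Induction on the variables. With the others fixed, the sum is a univariate polynomial in
  \<open>v\<close>; it is zero over an infinite field, and its coefficient at \<open>e\<close> is
  the sum over the slice of monomials with exponent \<open>e\<close> at \<open>v\<close>. On a slice
  the remaining exponents still tell the monomials apart.\<close>

lemma coeffs_eq_0_if_vanishing:
  fixes c :: "('v \<Rightarrow>\<^sub>0 nat) \<Rightarrow> 'k::field"
  assumes inf: "infinite (UNIV :: 'k set)"
    and "finite S" "finite M"
    and "\<And>\<mu> \<nu>. \<mu> \<in> M \<Longrightarrow> \<nu> \<in> M \<Longrightarrow>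
      (\<And>v. v \<in> S \<Longrightarrow> Poly_Mapping.lookup \<mu> v = Poly_Mapping.lookup \<nu> v) \<Longrightarrow> \<mu> = \<nu>"
    and "\<And>x. (\<Sum>\<mu>\<in>M. c \<mu> * (\<Prod>v\<in>S. x v ^ Poly_Mapping.lookup \<mu> v)) = 0"
  shows "\<forall>\<mu>\<in>M. c \<mu> = 0"
  using assms(2-)
proof (induction S arbitrary: M rule: finite_induct)
  case empty
  have "c \<mu> = 0" if "\<mu> \<in> M" for \<mu>
  proof -
    have "M = {\<mu>}" using empty(2) that by blast
    then show ?thesis using empty(3) by simp
  qed
  then show ?case by blast
next
  case (insert v S)
  let ?m = "\<lambda>x \<mu>. \<Prod>u\<in>S. x u ^ Poly_Mapping.lookup \<mu> u"
  show ?case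
  proof
    fix \<mu> assume \<mu>: "\<mu> \<in> M"
    define e where "e = Poly_Mapping.lookup \<mu> v"
    define M' where "M' = {\<nu>\<in>M. Poly_Mapping.lookup \<nu> v = e}"
    have "(\<Sum>\<nu>\<in>M'. c \<nu> * ?m x \<nu>) = 0" for x
    proof -
      define P where "P = (\<Sum>\<nu>\<in>M. monom (c \<nu> * ?m x \<nu>) (Poly_Mapping.lookup \<nu> v))"
      have "poly P t = 0" for t
      proof -
        have m: "(\<Prod>u\<in>S. (x(v := t)) u ^ Poly_Mapping.lookup \<nu> u) = ?m x \<nu>" for \<nu>
          using insert(2) by (intro prod.cong) auto
        have "poly P t = (\<Sum>\<nu>\<in>M. c \<nu> * (\<Prod>u\<in>insert v S. (x(v := t)) u ^ Poly_Mapping.lookup \<nu> u))"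
          unfolding P_def poly_sum
          by (intro sum.cong refl) (simp add: poly_monom prod.insert[OF insert(1,2)] m del: fun_upd_apply, simp)
        then show ?thesis using insert.prems(3) by simp
      qed
      then have "P = 0" by (rule poly_eq_0_infinite[OF inf])
      then have "coeff P e = 0" by simp
      then show ?thesis
        using insert.prems(1) by (simp add: P_def coeff_sum M'_def sum.inter_filter)
    qed
    moreover have "finite M'" using insert.prems(1) by (simp add: M'_def)
    moreover have "\<nu> = \<nu>'" if "\<nu> \<in> M'" "\<nu>' \<in> M'"
      "\<And>u. u \<in> S \<Longrightarrow> Poly_Mapping.lookup \<nu> u = Poly_Mapping.lookup \<nu>' u" for \<nu> \<nu>'
      using that(1,2) by (intro insert.prems(2)) (auto simp: M'_def that(3))
    ultimately have "\<forall>\<nu>\<in>M'. c \<nu> = 0" by (intro insert.IH) auto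
    then show "c \<mu> = 0" using \<mu> by (simp add: M'_def e_def)
  qed
qed

lemma finite_vars [simp]: "finite (vars p)"
  by (simp add: vars_def)

lemma exists_nonzero_eval:
  fixes p :: "('v, 'k::field) mpoly"
  assumes "infinite (UNIV :: 'k set)" "p \<noteq> 0"
  shows "\<exists>x. eval_at x p \<noteq> 0"
proof (rule ccontr)
  assume contra: "\<not> ?thesis"
  have eq: "eval_at x p =
      (\<Sum>\<mu>\<in>Poly_Mapping.keys p. Poly_Mapping.lookup p \<mu> * (\<Prod>v\<in>vars p. x v ^ Poly_Mapping.lookup \<mu> v))" for x
    unfolding eval_poly_def
    by (intro sum.cong refl arg_cong2[of _ _ _ _ "(*)"] mon_eval_superset) (auto simp: vars_def)
  have "\<forall>\<mu>\<in>Poly_Mapping.keys p. Poly_Mapping.lookup p \<mu> = 0"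
  proof (rule coeffs_eq_0_if_vanishing[OF assms(1) finite_vars[of p] finite_keys])
    fix \<mu> \<nu> assume *: "\<mu> \<in> Poly_Mapping.keys p" "\<nu> \<in> Poly_Mapping.keys p"
      "\<And>v. v \<in> vars p \<Longrightarrow> Poly_Mapping.lookup \<mu> v = Poly_Mapping.lookup \<nu> v"
    show "\<mu> = \<nu>"
    proof (rule poly_mapping_eqI)
      fix v show "Poly_Mapping.lookup \<mu> v = Poly_Mapping.lookup \<nu> v"
        using * by (cases "v \<in> vars p") (auto simp: vars_def in_keys_iff)
    qed
  qed (use contra eq in auto)
  then have "p = 0"
    by (intro poly_mapping_eqI) (metis in_keys_iff lookup_zero)
  then show False using assms(2) by simp
qed

text \<open>A linear order on the variables orders the monomials compatibly with addition, and this
  excludes zero divisors. For pairs of indices the order is the lexicographic one.\<close>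

lemma mpoly_prod_nonzero:
  fixes f :: "'i \<Rightarrow> ('v::linorder, 'k::field) mpoly"
  assumes "finite I" "\<And>i. i \<in> I \<Longrightarrow> f i \<noteq> 0"
  shows "(\<Prod>i\<in>I. f i) \<noteq> 0"
  using assms by simp

text \<open>Only the lowest-degree form of \<open>p\<close> at \<open>c\<close> contributes to the leading coefficient in \<open>t\<close>
  along the curve \<open>c + t x + t\<^sup>2 y\<close>, whatever \<open>y\<close> is.\<close>

lemma poly_eq_0_if_vanishing_on_curves:
  fixes p :: "('v, 'k::field) mpoly"
  assumes inf: "infinite (UNIV :: 'k set)"
    and curves: "\<And>x. \<exists>y. \<forall>t. eval_at (\<lambda>v. c v + t * x v + t\<^sup>2 * y v) p = 0"
  shows "p = 0"
proof (rule ccontr)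
  assume "p \<noteq> 0"
  \<comment> \<open>\<open>q\<close> is \<open>p\<close> with the base point \<open>c\<close> moved
    to the origin.\<close>
  define q where "q = eval_poly Const (\<lambda>v. Const (c v) + Var v) p"
  have q_eval: "eval_at x q = eval_at (\<lambda>v. c v + x v) p" for x
    unfolding q_def eval_poly_hom[OF comm_ring_hom_eval_poly[OF comm_ring_hom_id]]
      eval_poly_add[OF comm_ring_hom_id]
    by (simp add: eval_poly_Const[OF comm_ring_hom_id] eval_poly_Var[OF comm_ring_hom_id])
  obtain z where "eval_at z p \<noteq> 0"
    using exists_nonzero_eval[OF inf \<open>p \<noteq> 0\<close>] by blast
  then have "eval_at (\<lambda>v. z v - c v) q \<noteq> 0" by (simp add: q_eval)
  then have "q \<noteq> 0" by auto
  define deg where "deg = (\<lambda>\<mu> :: 'v \<Rightarrow>\<^sub>0 nat. \<Sum>v\<in>Poly_Mapping.keys \<mu>. Poly_Mapping.lookup \<mu> v)"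
  define d where "d = Min (deg ` Poly_Mapping.keys q)"
  have ne: "Poly_Mapping.keys q \<noteq> {}"
    using \<open>q \<noteq> 0\<close> by (metis emptyE in_keys_iff lookup_zero poly_mapping_eqI)
  have d_le: "d \<le> deg \<mu>" if "\<mu> \<in> Poly_Mapping.keys q" for \<mu>
    using that by (simp add: d_def)
  obtain \<mu>0 where \<mu>0: "\<mu>0 \<in> Poly_Mapping.keys q" "deg \<mu>0 = d"
  proof -
    have "d \<in> deg ` Poly_Mapping.keys q" unfolding d_def by (rule Min_in) (use ne in auto)
    then show thesis using that by auto
  qed
  \<comment> \<open>\<open>w\<close> is the homogeneous part of \<open>q\<close> of lowest degree
    \<open>d\<close>; it will be shown to vanish at every \<open>x\<close>.\<close>
  define L where "L = {\<mu>\<in>Poly_Mapping.keys q. deg \<mu> = d}"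
  define w where "w = (\<Sum>\<mu>\<in>L. Poly_Mapping.single \<mu> (Poly_Mapping.lookup q \<mu>))"
  have "finite L" by (simp add: L_def)
  have "eval_at x w = 0" for x
  proof -
    obtain y where y: "\<And>t. eval_at (\<lambda>v. c v + t * x v + t\<^sup>2 * y v) p = 0"
      using curves by blast
    \<comment> \<open>\<open>Q\<close> is the restriction of \<open>q\<close> to the curve
      \<open>t x + t^2 y\<close>, as a polynomial in \<open>t\<close>.\<close>
    define Q where "Q = eval_poly (\<lambda>a. [:a:]) (\<lambda>v. [:0, x v, y v:]) q"
    have "poly Q t = 0" for t
    proof -
      have "comm_ring_hom (\<lambda>P. poly P t)" by unfold_locales auto
      then have "poly Q t = eval_at (\<lambda>v. t * x v + t\<^sup>2 * y v) q"
        unfolding Q_def by (subst eval_poly_hom) (simp_all add: algebra_simps power2_eq_square)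
      then show ?thesis using y[of t] by (simp add: q_eval algebra_simps)
    qed
    then have "Q = 0" by (rule poly_eq_0_infinite[OF inf])
    \<comment> \<open>A monomial \<open>\<mu>\<close> restricts to \<open>t ^ deg \<mu>\<close>
      times a polynomial whose constant term does not involve \<open>y\<close>; hence the
      coefficient of \<open>Q\<close> at \<open>d\<close> is the value of \<open>w\<close> at
      \<open>x\<close>.\<close>
    have mon: "mon_eval (\<lambda>v. [:0, x v, y v:]) \<mu> = monom 1 (deg \<mu>) * mon_eval (\<lambda>v. [:x v, y v:]) \<mu>" for \<mu>
    proof -
      have x: "[:0, x v, y v:] = monom 1 1 * [:x v, y v:]" for v
        by (simp add: monom_altdef)
      have m: "(\<Prod>v\<in>S. (monom 1 1 :: 'k poly) ^ f v) = monom 1 (\<Sum>v\<in>S. f v)"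
        for S and f :: "'v \<Rightarrow> nat"
        by (simp add: monom_altdef power_sum)
      show ?thesis
        unfolding mon_eval_def deg_def x power_mult_distrib prod.distrib m ..
    qed
    have "coeff ([:Poly_Mapping.lookup q \<mu>:] * mon_eval (\<lambda>v. [:0, x v, y v:]) \<mu>) d =
        (if deg \<mu> = d then Poly_Mapping.lookup q \<mu> * mon_eval x \<mu> else 0)"
      if "\<mu> \<in> Poly_Mapping.keys q" for \<mu>
    proof -
      have "coeff (mon_eval (\<lambda>v. [:x v, y v:]) \<mu>) 0 = mon_eval x \<mu>"
        unfolding poly_0_coeff_0[symmetric]
        by (subst mon_eval_hom[where g = "\<lambda>P. poly P 0"], unfold_locales) auto
      then show ?thesis
        using d_le[OF that] by (auto simp: mon coeff_monom_mult)
    qed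
    then have "coeff Q d = (\<Sum>\<mu>\<in>L. Poly_Mapping.lookup q \<mu> * mon_eval x \<mu>)"
      unfolding Q_def eval_poly_def coeff_sum L_def by (simp add: sum.inter_filter)
    then show ?thesis
      using \<open>Q = 0\<close> by (simp add: w_def eval_poly_sum[OF comm_ring_hom_id] eval_poly_single[OF comm_ring_hom_id])
  qed
  then have "w = 0" using exists_nonzero_eval[OF inf] by blast
  moreover have "Poly_Mapping.lookup w \<mu>0 = Poly_Mapping.lookup q \<mu>0"
    using \<mu>0 \<open>finite L\<close> by (simp add: w_def lookup_sum lookup_single when_def L_def)
  ultimately show False using \<mu>0 by (simp add: in_keys_iff)
qed

section \<open>The determinantal ideals\<close>

lemma vars_0 [simp]: "vars 0 = {}"
  by (simp add: vars_def)

lemma vars_Const [simp]: "vars (Const c) = {}"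
  by (auto simp: vars_def Const_def)

lemma vars_1 [simp]: "vars 1 = {}"
  by (auto simp: vars_def)

lemma vars_Var: "vars (Var v) \<subseteq> {v}"
  by (auto simp: vars_def Var_def split: if_splits)

lemma vars_add: "vars (p + q) \<subseteq> vars p \<union> vars q"
  using Poly_Mapping.keys_add[of p q] by (auto simp: vars_def)

lemma vars_uminus [simp]: "vars (- p) = vars p"
  by (auto simp: vars_def in_keys_iff)

lemma vars_mult: "vars (p * q) \<subseteq> vars p \<union> vars q"
proof
  fix v assume "v \<in> vars (p * q)"
  then obtain \<mu> where \<mu>: "\<mu> \<in> Poly_Mapping.keys (p * q)" "v \<in> Poly_Mapping.keys \<mu>"
    by (auto simp: vars_def)
  then obtain a b where ab: "\<mu> = a + b" "a \<in> Poly_Mapping.keys p" "b \<in> Poly_Mapping.keys q"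
    using keys_mult[of p q] by blast
  then have "v \<in> Poly_Mapping.keys a \<union> Poly_Mapping.keys b"
    using \<mu> Poly_Mapping.keys_add[of a b] by auto
  then show "v \<in> vars p \<union> vars q" using ab by (auto simp: vars_def)
qed

lemma vars_add_subset: "vars p \<subseteq> S \<Longrightarrow> vars q \<subseteq> S \<Longrightarrow> vars (p + q) \<subseteq> S"
  using vars_add[of p q] by auto

lemma vars_mult_subset: "vars p \<subseteq> S \<Longrightarrow> vars q \<subseteq> S \<Longrightarrow> vars (p * q) \<subseteq> S"
  using vars_mult[of p q] by auto

lemma vars_power_subset: "vars p \<subseteq> S \<Longrightarrow> vars (p ^ e) \<subseteq> S"
  by (induction e) (simp_all add: vars_mult_subset)

lemma vars_sum_subset: "(\<And>i. i \<in> I \<Longrightarrow> vars (f i) \<subseteq> S) \<Longrightarrow> vars (\<Sum>i\<in>I. f i) \<subseteq> S"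
  by (induction I rule: infinite_finite_induct) (simp_all add: vars_add_subset)

lemma vars_prod_subset: "(\<And>i. i \<in> I \<Longrightarrow> vars (f i) \<subseteq> S) \<Longrightarrow> vars (\<Prod>i\<in>I. f i) \<subseteq> S"
  by (induction I rule: infinite_finite_induct) (simp_all add: vars_mult_subset)

lemma vars_of_nat_subset: "vars (of_nat k) \<subseteq> S"
  by (induction k) (simp_all add: vars_add_subset)

lemma vars_det_subset:
  assumes "M \<in> carrier_mat s s" "\<And>i j. i < s \<Longrightarrow> j < s \<Longrightarrow> vars (M $$ (i, j)) \<subseteq> S"
  shows "vars (det M) \<subseteq> S"
  unfolding det_def'[OF assms(1)]
proof (intro vars_sum_subset vars_mult_subset vars_prod_subset)
  fix p assume "p \<in> {p. p permutes {0..<s}}"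
  then have p: "p permutes {0..<s}" by simp
  show "vars (of_int (sign p)) \<subseteq> S" by (cases "sign p = 1") (auto simp: sign_def)
  fix i assume "i \<in> {0..<s}"
  then show "vars (M $$ (i, p i)) \<subseteq> S" using permutes_in_image[OF p] by (intro assms(2)) auto
qed

section \<open>The polynomial ring as a ring structure, and homomorphisms out of it\<close>

lemma cring_poly_ring: "cring (poly_ring V)"
proof (rule cringI)
  show "abelian_group (poly_ring V)"
  proof (rule abelian_groupI)
    fix x assume "x \<in> carrier (poly_ring V)"
    then show "\<exists>y\<in>carrier (poly_ring V). y \<oplus>\<^bsub>poly_ring V\<^esub> x = \<zero>\<^bsub>poly_ring V\<^esub>"
      by (intro bexI[of _ "- x"]) (auto simp: poly_ring_def)
  qed (simp_all add: poly_ring_def algebra_simps vars_add_subset)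
  show "comm_monoid (poly_ring V)"
    by (rule comm_monoidI) (simp_all add: poly_ring_def algebra_simps vars_mult_subset)
qed (auto simp: poly_ring_def algebra_simps)

lemma finsum_poly_ring:
  assumes "\<And>i. i \<in> A \<Longrightarrow> vars (f i) \<subseteq> V"
  shows "finsum (poly_ring V) f A = (\<Sum>i\<in>A. f i)"
proof -
  interpret cring "poly_ring V" by (rule cring_poly_ring)
  show ?thesis
    using assms
  proof (induction A rule: infinite_finite_induct)
    case (insert i A)
    then have "finsum (poly_ring V) f (insert i A) = f i \<oplus>\<^bsub>poly_ring V\<^esub> finsum (poly_ring V) f A"
      by (intro finsum_insert) (auto simp: poly_ring_def)
    then show ?case using insert by (simp add: poly_ring_def)
  qed (auto simp: finsum_infinite, auto simp: poly_ring_def)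
qed

lemma finprod_poly_ring:
  assumes "\<And>i. i \<in> A \<Longrightarrow> vars (f i) \<subseteq> V"
  shows "finprod (poly_ring V) f A = (\<Prod>i\<in>A. f i)"
proof -
  interpret cring "poly_ring V" by (rule cring_poly_ring)
  show ?thesis
    using assms
  proof (induction A rule: infinite_finite_induct)
    case (insert i A)
    then have "finprod (poly_ring V) f (insert i A) = f i \<otimes>\<^bsub>poly_ring V\<^esub> finprod (poly_ring V) f A"
      by (intro finprod_insert) (auto simp: poly_ring_def)
    then show ?case using insert by (simp add: poly_ring_def)
  qed (auto simp: finprod_infinite, auto simp: poly_ring_def)
qed

lemma nat_pow_poly_ring: "p [^]\<^bsub>poly_ring V\<^esub> (e::nat) = p ^ e"
  by (induction e) (auto simp: poly_ring_def nat_pow_def mult.commute)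

text \<open>Taken with the projection onto the quotient, this turns an algebraic relation between
  the cosets of the variables into a statement about the coset of one polynomial.\<close>

lemma poly_eval_hom:
  assumes "ring_hom_cring (poly_ring V) R h" "vars p \<subseteq> V"
  shows "poly_eval R (\<lambda>c. h (Const c)) (\<lambda>v. h (Var v)) p = h p"
proof -
  interpret ring_hom_cring "poly_ring V" R h by fact
  have rh: "ring_hom_ring (poly_ring V) R h"
    using homh by (intro ring_hom_ringI2) unfold_locales
  have carr: "q \<in> carrier (poly_ring V) \<longleftrightarrow> vars q \<subseteq> V" for q
    by (simp add: poly_ring_def)
  have V: "Poly_Mapping.keys \<mu> \<subseteq> V" if "\<mu> \<in> Poly_Mapping.keys p" for \<mu>
    using that assms(2) by (auto simp: vars_def)
  have Var: "vars (Var v ^ e :: ('a, 'b) mpoly) \<subseteq> V" if "v \<in> V" for v e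
    using that vars_Var[of v] by (intro vars_power_subset) auto
  have mon: "(\<Otimes>\<^bsub>R\<^esub>v\<in>Poly_Mapping.keys \<mu>. h (Var v) [^]\<^bsub>R\<^esub> Poly_Mapping.lookup \<mu> v) = h (mon_eval Var \<mu>)"
    if "\<mu> \<in> Poly_Mapping.keys p" for \<mu>
  proof -
    have "h (mon_eval Var \<mu>) = h (\<Otimes>\<^bsub>poly_ring V\<^esub>v\<in>Poly_Mapping.keys \<mu>. Var v ^ Poly_Mapping.lookup \<mu> v)"
      unfolding mon_eval_def by (subst finprod_poly_ring) (use V[OF that] Var in auto)
    also have "\<dots> = (\<Otimes>\<^bsub>R\<^esub>v\<in>Poly_Mapping.keys \<mu>. h (Var v ^ Poly_Mapping.lookup \<mu> v))"
      by (subst hom_finprod) (use V[OF that] Var in \<open>auto simp: carr o_def\<close>)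
    also have "\<dots> = (\<Otimes>\<^bsub>R\<^esub>v\<in>Poly_Mapping.keys \<mu>. h (Var v) [^]\<^bsub>R\<^esub> Poly_Mapping.lookup \<mu> v)"
    proof (rule S.finprod_cong')
      fix v assume "v \<in> Poly_Mapping.keys \<mu>"
      then have "v \<in> V" using V[OF that] by auto
      then have "(Var v :: ('a, 'b) mpoly) \<in> carrier (poly_ring V)" using Var[of v 1] by (simp add: carr)
      then show "h (Var v ^ Poly_Mapping.lookup \<mu> v) = h (Var v) [^]\<^bsub>R\<^esub> Poly_Mapping.lookup \<mu> v"
        by (simp flip: nat_pow_poly_ring[of V] add: ring_hom_ring.hom_nat_pow[OF rh])
    qed (use V[OF that] Var[of _ 1] in \<open>auto simp: carr\<close>)
    finally show ?thesis by simp
  qed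
  have mon_vars: "vars (mon_eval Var \<mu> :: ('a, 'b) mpoly) \<subseteq> V" if "\<mu> \<in> Poly_Mapping.keys p" for \<mu>
    unfolding mon_eval_def using V[OF that] Var by (intro vars_prod_subset) auto
  have term_vars: "vars (Const (Poly_Mapping.lookup p \<mu>) * mon_eval Var \<mu>) \<subseteq> V"
    if "\<mu> \<in> Poly_Mapping.keys p" for \<mu>
    using mon_vars[OF that] by (intro vars_mult_subset) auto
  have "h p = h (eval_poly Const Var p)" by (simp add: eval_poly_Const_Var)
  also have "\<dots> = h (\<Oplus>\<^bsub>poly_ring V\<^esub>\<mu>\<in>Poly_Mapping.keys p. Const (Poly_Mapping.lookup p \<mu>) * mon_eval Var \<mu>)"
    unfolding eval_poly_def by (subst finsum_poly_ring) (use term_vars in auto)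
  also have "\<dots> = (\<Oplus>\<^bsub>R\<^esub>\<mu>\<in>Poly_Mapping.keys p. h (Const (Poly_Mapping.lookup p \<mu>) * mon_eval Var \<mu>))"
    by (subst hom_finsum) (use term_vars in \<open>auto simp: carr o_def\<close>)
  also have "\<dots> = poly_eval R (\<lambda>c. h (Const c)) (\<lambda>v. h (Var v)) p"
    unfolding poly_eval_def
  proof (rule S.finsum_cong')
    fix \<mu> assume \<mu>: "\<mu> \<in> Poly_Mapping.keys p"
    have "h (Const (Poly_Mapping.lookup p \<mu>) * mon_eval Var \<mu>) =
        h (Const (Poly_Mapping.lookup p \<mu>)) \<otimes>\<^bsub>R\<^esub> h (mon_eval Var \<mu>)"
    proof -
      have "Const (Poly_Mapping.lookup p \<mu>) * mon_eval Var \<mu> =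
          Const (Poly_Mapping.lookup p \<mu>) \<otimes>\<^bsub>poly_ring V\<^esub> mon_eval Var \<mu>"
        by (simp add: poly_ring_def)
      then show ?thesis using mon_vars[OF \<mu>] by (simp add: carr)
    qed
    then show "h (Const (Poly_Mapping.lookup p \<mu>) * mon_eval Var \<mu>) =
        h (Const (Poly_Mapping.lookup p \<mu>)) \<otimes>\<^bsub>R\<^esub>
          (\<Otimes>\<^bsub>R\<^esub>v\<in>Poly_Mapping.keys \<mu>. h (Var v) [^]\<^bsub>R\<^esub> Poly_Mapping.lookup \<mu> v)"
      by (simp add: mon[OF \<mu>])
  next
    show "(\<lambda>\<mu>. h (Const (Poly_Mapping.lookup p \<mu>)) \<otimes>\<^bsub>R\<^esub>
          (\<Otimes>\<^bsub>R\<^esub>v\<in>Poly_Mapping.keys \<mu>. h (Var v) [^]\<^bsub>R\<^esub> Poly_Mapping.lookup \<mu> v))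
        \<in> Poly_Mapping.keys p \<rightarrow> carrier R"
      using mon mon_vars by (auto simp: carr)
  qed simp
  finally show ?thesis by simp
qed

section \<open>Minors of the generic matrix\<close>

lemma card_restrict:
  assumes "A \<subseteq> {..<m}"
  shows "{i. i < m \<and> i \<in> A} = A"
  using assms by auto

lemma submatrix_dims:
  assumes "A \<subseteq> {..<dim_row M}" "B \<subseteq> {..<dim_col M}" "card A = s" "card B = s"
  shows "submatrix M A B \<in> carrier_mat s s"
  using assms card_restrict[of A "dim_row M"] card_restrict[of B "dim_col M"]
  by (intro carrier_matI) (auto simp: dim_submatrix)

lemma submatrix_entry:
  assumes "A \<subseteq> {..<dim_row M}" "B \<subseteq> {..<dim_col M}" "a < card A" "b < card B"
  shows "submatrix M A B $$ (a, b) = M $$ (pick A a, pick B b)"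
  using assms card_restrict[of A "dim_row M"] card_restrict[of B "dim_col M"]
  by (intro submatrix_index) auto

lemma generic_dims [simp]: "dim_row (generic_matrix m n) = m" "dim_col (generic_matrix m n) = n"
  by (simp_all add: generic_matrix_def)

lemma generic_submatrix_dims:
  assumes "A \<subseteq> {..<m}" "B \<subseteq> {..<n}" "card A = s" "card B = s"
  shows "submatrix (generic_matrix m n) A B \<in> carrier_mat s s"
  using assms by (intro submatrix_dims) auto

lemma generic_submatrix_entry:
  assumes "A \<subseteq> {..<m}" "B \<subseteq> {..<n}" "a < card A" "b < card B"
  shows "submatrix (generic_matrix m n) A B $$ (a, b) = Var (pick A a, pick B b)"
proof -
  have "pick A a \<in> A" "pick B b \<in> B" using assms by (auto intro: pick_in_set_le)
  then have "pick A a < m" "pick B b < n" using assms by auto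
  then show ?thesis
    using assms by (subst submatrix_entry) (auto simp: generic_matrix_def)
qed

lemma vars_generic_minor:
  assumes "A \<subseteq> {..<m}" "B \<subseteq> {..<n}" "card A = s" "card B = s"
  shows "vars (det (submatrix (generic_matrix m n) A B)) \<subseteq> A \<times> B"
proof (rule vars_det_subset[OF generic_submatrix_dims[OF assms]])
  fix i j assume "i < s" "j < s"
  then show "vars (submatrix (generic_matrix m n) A B $$ (i, j)) \<subseteq> A \<times> B"
    using assms vars_Var[of "(pick A i, pick B j)"] pick_in_set_le[of i A] pick_in_set_le[of j B]
    by (subst generic_submatrix_entry) auto
qed

lemma generic_minors_subset:
  "generic_minors s m n \<subseteq> carrier (poly_ring ({..<m} \<times> {..<n}))"
proof
  fix p :: "(nat \<times> nat, 'a) mpoly" assume "p \<in> generic_minors s m n"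
  then obtain A B where "A \<subseteq> {..<m}" "B \<subseteq> {..<n}" "card A = s" "card B = s"
    and "p = det (submatrix (generic_matrix m n) A B)"
    by (auto simp: generic_minors_def)
  then show "p \<in> carrier (poly_ring ({..<m} \<times> {..<n}))"
    using vars_generic_minor[of A m B n s] by (auto simp: poly_ring_def)
qed

section \<open>Membership in the determinantal ideals\<close>

lemma ideal_det_ideal: "ideal (det_ideal s m n) (poly_ring ({..<m} \<times> {..<n}))"
  unfolding det_ideal_def
  by (intro ring.genideal_ideal cring.axioms(1) cring_poly_ring generic_minors_subset)

lemma det_ideal_gen: "p \<in> generic_minors s m n \<Longrightarrow> p \<in> det_ideal s m n"
  unfolding det_ideal_def
  using ring.genideal_self[OF cring.axioms(1)[OF cring_poly_ring] generic_minors_subset] by blast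

lemma det_ideal_0: "0 \<in> det_ideal s m n"
proof -
  interpret ideal "det_ideal s m n" "poly_ring ({..<m} \<times> {..<n})" by (rule ideal_det_ideal)
  show ?thesis using additive_subgroup.zero_closed[OF is_additive_subgroup] by (simp add: poly_ring_def)
qed

lemma det_ideal_add: "p \<in> det_ideal s m n \<Longrightarrow> q \<in> det_ideal s m n \<Longrightarrow> p + q \<in> det_ideal s m n"
proof -
  interpret ideal "det_ideal s m n" "poly_ring ({..<m} \<times> {..<n})" by (rule ideal_det_ideal)
  show "p \<in> det_ideal s m n \<Longrightarrow> q \<in> det_ideal s m n \<Longrightarrow> p + q \<in> det_ideal s m n"
    using additive_subgroup.a_closed[OF is_additive_subgroup, of p q] by (simp add: poly_ring_def)
qed

lemma det_ideal_mult:
  "q \<in> det_ideal s m n \<Longrightarrow> vars p \<subseteq> {..<m} \<times> {..<n} \<Longrightarrow> p * q \<in> det_ideal s m n"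
proof -
  interpret ideal "det_ideal s m n" "poly_ring ({..<m} \<times> {..<n})" by (rule ideal_det_ideal)
  show "q \<in> det_ideal s m n \<Longrightarrow> vars p \<subseteq> {..<m} \<times> {..<n} \<Longrightarrow> p * q \<in> det_ideal s m n"
    using I_l_closed[of q p] by (simp add: poly_ring_def)
qed

lemma det_ideal_sum: "(\<And>i. i \<in> I \<Longrightarrow> f i \<in> det_ideal s m n) \<Longrightarrow> (\<Sum>i\<in>I. f i) \<in> det_ideal s m n"
  by (induction I rule: infinite_finite_induct) (auto simp: det_ideal_0 det_ideal_add)

text \<open>An induction principle for the ideal: closure conditions in ordinary arithmetic make
  \<open>K\<close> an ideal of the ring structure, with negatives obtained from multiplication by
  \<open>- 1\<close>.\<close>

lemma det_ideal_minimal: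
  fixes K :: "(nat \<times> nat, 'k::comm_ring_1) mpoly set"
  assumes "\<And>p. p \<in> K \<Longrightarrow> vars p \<subseteq> {..<m} \<times> {..<n}"
    and "0 \<in> K" and "\<And>p q. p \<in> K \<Longrightarrow> q \<in> K \<Longrightarrow> p + q \<in> K"
    and mult: "\<And>p q. q \<in> K \<Longrightarrow> vars p \<subseteq> {..<m} \<times> {..<n} \<Longrightarrow> p * q \<in> K"
    and "generic_minors s m n \<subseteq> K"
  shows "det_ideal s m n \<subseteq> K"
proof -
  let ?R = "poly_ring ({..<m} \<times> {..<n}) :: ((nat \<times> nat, 'k) mpoly) ring"
  interpret cring ?R by (rule cring_poly_ring)
  have neg: "- p \<in> K" if "p \<in> K" for p
    using mult[OF that, of "- 1"] by simp
  have a_inv: "\<ominus>\<^bsub>?R\<^esub> p = - p" if "p \<in> carrier ?R" for p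
    by (rule minus_equality) (use that in \<open>auto simp: poly_ring_def\<close>)
  have "ideal K ?R"
  proof (rule idealI)
    show "subgroup K (add_monoid ?R)"
    proof (rule add.subgroupI)
      fix p assume "p \<in> K"
      then show "\<ominus>\<^bsub>?R\<^esub> p \<in> K"
        using a_inv[of p] neg[of p] assms(1)[of p] by (simp add: poly_ring_def)
    qed (use assms in \<open>auto simp: poly_ring_def\<close>)
  next
    show "ring ?R" by unfold_locales
  qed (use assms in \<open>auto simp: poly_ring_def mult.commute\<close>)
  then show ?thesis
    unfolding det_ideal_def by (rule genideal_minimal) fact
qed

lemma det_proj_eq_zero_iff:
  assumes "vars p \<subseteq> {..<m} \<times> {..<n}"
  shows "det_proj r m n p = \<zero>\<^bsub>det_coord_ring r m n\<^esub> \<longleftrightarrow> p \<in> det_ideal (r + 1) m n"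
proof -
  let ?R = "poly_ring ({..<m} \<times> {..<n}) :: ((nat \<times> nat, 'a) mpoly) ring"
  interpret ideal "det_ideal (r + 1) m n" ?R by (rule ideal_det_ideal)
  show ?thesis
    using a_rcos_const[of p] a_rcos_self[of p] assms
    by (auto simp: det_proj_def det_coord_ring_def FactRing_def poly_ring_def)
qed

text \<open>A relation between cosets is a polynomial whose coset is zero, that is, one in the
  ideal. Both independence and maximality are proved in terms of this membership.\<close>

lemma det_matroid_indep_iff:
  "det_matroid_indep TYPE('k::field) r m n \<Omega> \<longleftrightarrow>
     \<Omega> \<subseteq> {..<m} \<times> {..<n} \<and>
     (\<forall>p :: (nat \<times> nat, 'k) mpoly. vars p \<subseteq> \<Omega> \<longrightarrow> p \<in> det_ideal (r + 1) m n \<longrightarrow> p = 0)"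
proof (cases "\<Omega> \<subseteq> {..<m} \<times> {..<n}")
  case True
  let ?V = "{..<m} \<times> {..<n}"
  let ?R = "poly_ring ?V :: ((nat \<times> nat, 'k) mpoly) ring"
  have "ring_hom_cring ?R (det_coord_ring r m n) (det_proj r m n)"
    unfolding det_coord_ring_def det_proj_def
    by (intro ideal.rcos_ring_hom_cring ideal_det_ideal cring_poly_ring)
  then have "poly_eval (det_coord_ring r m n) (\<lambda>c :: 'k. det_proj r m n (Const c))
       (\<lambda>v. det_proj r m n (Var v)) p = \<zero>\<^bsub>det_coord_ring r m n\<^esub> \<longleftrightarrow> p \<in> det_ideal (r + 1) m n"
    if "vars p \<subseteq> \<Omega>" for p :: "(nat \<times> nat, 'k) mpoly"
    using that True by (subst poly_eval_hom[where V = ?V]) (auto simp: det_proj_eq_zero_iff)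
  then show ?thesis
    using True by (simp add: det_matroid_indep_def alg_indep_def)
qed (simp add: det_matroid_indep_def)

section \<open>Minors vanish on matrices of small rank\<close>

text \<open>Padding both factors with zeros to size \<open>s\<close> gives square matrices, and row
  \<open>r\<close> of the second one is zero since \<open>r < s\<close>.\<close>

lemma det_mult_small_inner:
  fixes f :: "nat \<Rightarrow> nat \<Rightarrow> 'k::field"
  assumes "r < s"
  shows "det (mat s s (\<lambda>(a, b). \<Sum>l<r. f a l * g l b)) = 0"
proof -
  define F where "F = mat s s (\<lambda>(a, l). if l < r then f a l else 0)"
  define G where "G = mat s s (\<lambda>(l, b). if l < r then g l b else 0)"
  have car: "F \<in> carrier_mat s s" "G \<in> carrier_mat s s" by (auto simp: F_def G_def)
  have "mat s s (\<lambda>(a, b). \<Sum>l<r. f a l * g l b) = F * G"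
  proof (rule eq_matI)
    fix a b assume ab: "a < dim_row (F * G)" "b < dim_col (F * G)"
    have "(F * G) $$ (a, b) = (\<Sum>l = 0..<s. F $$ (a, l) * G $$ (l, b))"
      using ab car by (simp add: scalar_prod_def)
    also have "\<dots> = (\<Sum>l = 0..<s. if l < r then f a l * g l b else 0)"
      using ab by (intro sum.cong) (auto simp: F_def G_def)
    also have "\<dots> = (\<Sum>l<r. f a l * g l b)"
      using assms by (intro sum.mono_neutral_cong_right) auto
    finally show "mat s s (\<lambda>(a, b). \<Sum>l<r. f a l * g l b) $$ (a, b) = (F * G) $$ (a, b)"
      using ab car by simp
  qed (use car in auto)
  moreover have "det G = 0"
  proof -
    have "G = mat\<^sub>r s s (\<lambda>i. if i = r then 0\<^sub>v s else row G i)"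
      using assms by (intro eq_matI) (auto simp: G_def)
    also have "det \<dots> = 0"
      using assms car by (intro det_row_0) auto
    finally show ?thesis .
  qed
  ultimately show ?thesis using det_mult[OF car] by simp
qed

text \<open>The polynomials vanishing at a fixed product matrix form an ideal, and it contains the
  generating minors by \<open>det_mult_small_inner\<close>.\<close>

lemma det_ideal_vanishes:
  fixes A B :: "nat \<times> nat \<Rightarrow> 'k::field"
  assumes "p \<in> det_ideal (r + 1) m n"
  shows "eval_at (\<lambda>(i, j). \<Sum>l<r. A (i, l) * B (l, j)) p = 0"
proof -
  define x where "x = (\<lambda>(i, j). \<Sum>l<r. A (i, l) * B (l, j))"
  interpret ev: comm_ring_hom "eval_at x" by (rule comm_ring_hom_eval_poly[OF comm_ring_hom_id])
  define K where "K = {p. vars p \<subseteq> {..<m} \<times> {..<n} \<and> eval_at x p = 0}"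
  have "det_ideal (r + 1) m n \<subseteq> K"
  proof (rule det_ideal_minimal)
    show "generic_minors (r + 1) m n \<subseteq> K"
    proof
      fix q :: "(nat \<times> nat, 'k) mpoly" assume "q \<in> generic_minors (r + 1) m n"
      then obtain I J where IJ: "I \<subseteq> {..<m}" "J \<subseteq> {..<n}" "card I = r + 1" "card J = r + 1"
        and q: "q = det (submatrix (generic_matrix m n) I J)"
        by (auto simp: generic_minors_def)
      have "map_mat (eval_at x) (submatrix (generic_matrix m n) I J) =
          mat (r + 1) (r + 1) (\<lambda>(a, b). \<Sum>l<r. A (pick I a, l) * B (l, pick J b))"
        using generic_submatrix_dims[OF IJ] IJ
        by (intro eq_matI) (auto simp: generic_submatrix_entry eval_poly_Var[OF comm_ring_hom_id] x_def)
      then have "eval_at x q = 0"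
        unfolding q ev.hom_det[symmetric] by (simp add: det_mult_small_inner)
      moreover have "vars q \<subseteq> {..<m} \<times> {..<n}"
        using vars_generic_minor[OF IJ] IJ unfolding q by blast
      ultimately show "q \<in> K" by (simp add: K_def)
    qed
  qed (simp_all add: K_def ev.hom_add ev.hom_mult vars_add_subset vars_mult_subset)
  then show ?thesis using assms by (auto simp: K_def x_def)
qed

section \<open>Dependence of large sets\<close>

text \<open>Gaussian elimination on the equations \<open>B\<close>: an equation with a nonzero
  coefficient is used up to remove one unknown, which keeps the unknowns \<open>A\<close> in the
  majority.\<close>

lemma homogeneous_system:
  fixes f :: "'a \<Rightarrow> 'b \<Rightarrow> 'k::field"
  assumes "finite B" "finite A" "card B < card A"
  shows "\<exists>c. (\<exists>a\<in>A. c a \<noteq> 0) \<and> (\<forall>b\<in>B. (\<Sum>a\<in>A. c a * f a b) = 0)"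
  using assms
proof (induction B arbitrary: A f rule: finite_induct)
  case empty
  then obtain a where "a \<in> A" by fastforce
  then show ?case by (intro exI[of _ "\<lambda>_. 1"]) auto
next
  case (insert b B)
  show ?case
  proof (cases "\<forall>a\<in>A. f a b = 0")
    case True
    have "card B < card A" using insert by simp
    then obtain c where "\<exists>a\<in>A. c a \<noteq> 0" "\<forall>b\<in>B. (\<Sum>a\<in>A. c a * f a b) = 0"
      using insert.IH[OF insert.prems(1), of f] by blast
    then show ?thesis using True by (intro exI[of _ c]) auto
  next
    case False
    then obtain a0 where a0: "a0 \<in> A" "f a0 b \<noteq> 0" by auto
    \<comment> \<open>\<open>f'\<close> is the system after \<open>a0\<close> has been eliminated by
      means of equation \<open>b\<close>; \<open>t\<close> below is the value that this equation
      then forces on \<open>a0\<close>.\<close>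
    define f' where "f' a b' = f a b' - f a b / f a0 b * f a0 b'" for a b'
    have "card B < card (A - {a0})" using insert a0 by auto
    then obtain c where c: "\<exists>a\<in>A - {a0}. c a \<noteq> 0"
      "\<forall>b'\<in>B. (\<Sum>a\<in>A - {a0}. c a * f' a b') = 0"
      using insert.IH[of "A - {a0}" f'] insert.prems by auto
    define t where "t = - (\<Sum>a\<in>A - {a0}. c a * f a b) / f a0 b"
    define c' where "c' = c(a0 := t)"
    have split: "(\<Sum>a\<in>A. c' a * f a b') = t * f a0 b' + (\<Sum>a\<in>A - {a0}. c a * f a b')" for b'
      using a0 insert.prems
      by (subst sum.remove[of _ a0]) (auto simp: c'_def intro!: sum.cong)
    have "(\<Sum>a\<in>A. c' a * f a b') = 0" if "b' \<in> insert b B" for b'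
    proof (cases "b' = b")
      case True
      then show ?thesis using a0 by (simp add: split t_def)
    next
      case False
      then have "(\<Sum>a\<in>A - {a0}. c a * f' a b') = 0" using c that by auto
      moreover have "(\<Sum>a\<in>A - {a0}. c a * f' a b') =
          (\<Sum>a\<in>A - {a0}. c a * f a b') - (\<Sum>a\<in>A - {a0}. c a * f a b) / f a0 b * f a0 b'"
        by (simp add: f'_def algebra_simps sum_subtractf sum_distrib_left sum_divide_distrib)
      ultimately show ?thesis by (simp add: split t_def)
    qed
    moreover have "\<exists>a\<in>A. c' a \<noteq> 0" using c(1) by (auto simp: c'_def)
    ultimately show ?thesis by blast
  qed
qed

text \<open>Each exponent is bounded separately, rather than the total degree, so that the number of
  monomials is an exact power.\<close>

definition box_monomials :: "'v set \<Rightarrow> nat \<Rightarrow> ('v \<Rightarrow>\<^sub>0 nat) set" where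
  "box_monomials Y d = {\<mu>. Poly_Mapping.keys \<mu> \<subseteq> Y \<and> (\<forall>v. Poly_Mapping.lookup \<mu> v \<le> d)}"

definition box_polys :: "'v set \<Rightarrow> nat \<Rightarrow> ('v, 'k::comm_ring_1) mpoly set" where
  "box_polys Y d = {p. Poly_Mapping.keys p \<subseteq> box_monomials Y d}"

lemma card_box_monomials:
  assumes "finite Y"
  shows "finite (box_monomials Y d)" "card (box_monomials Y d) = (d + 1) ^ card Y"
proof -
  have "bij_betw (\<lambda>\<mu>. restrict (Poly_Mapping.lookup \<mu>) Y) (box_monomials Y d) (Y \<rightarrow>\<^sub>E {..d})"
  proof (rule bij_betwI')
    fix \<mu> \<nu> assume *: "\<mu> \<in> box_monomials Y d" "\<nu> \<in> box_monomials Y d"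
    show "restrict (Poly_Mapping.lookup \<mu>) Y = restrict (Poly_Mapping.lookup \<nu>) Y \<longleftrightarrow> \<mu> = \<nu>"
    proof
      assume eq: "restrict (Poly_Mapping.lookup \<mu>) Y = restrict (Poly_Mapping.lookup \<nu>) Y"
      show "\<mu> = \<nu>"
      proof (rule poly_mapping_eqI)
        fix v show "Poly_Mapping.lookup \<mu> v = Poly_Mapping.lookup \<nu> v"
        proof (cases "v \<in> Y")
          case True
          then show ?thesis using fun_cong[OF eq, of v] by simp
        next
          case False
          then have "v \<notin> Poly_Mapping.keys \<mu>" "v \<notin> Poly_Mapping.keys \<nu>"
            using * by (auto simp: box_monomials_def)
          then show ?thesis by (simp add: in_keys_iff)
        qed
      qed
    qed simp
  next
    fix \<mu> assume "\<mu> \<in> box_monomials Y d"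
    then show "restrict (Poly_Mapping.lookup \<mu>) Y \<in> Y \<rightarrow>\<^sub>E {..d}" by (auto simp: box_monomials_def)
  next
    fix f assume f: "f \<in> Y \<rightarrow>\<^sub>E {..d}"
    define \<mu> where "\<mu> = Abs_poly_mapping (\<lambda>v. if v \<in> Y then f v else 0)"
    have "finite {v. (if v \<in> Y then f v else 0) \<noteq> 0}"
      by (rule finite_subset[OF _ assms]) auto
    then have l: "Poly_Mapping.lookup \<mu> v = (if v \<in> Y then f v else 0)" for v
      by (simp add: \<mu>_def)
    show "\<exists>\<mu>\<in>box_monomials Y d. f = restrict (Poly_Mapping.lookup \<mu>) Y"
    proof (rule bexI)
      show "f = restrict (Poly_Mapping.lookup \<mu>) Y"
        using PiE_arb[OF f] by (intro ext) (simp add: l)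
      show "\<mu> \<in> box_monomials Y d"
        using f by (auto simp: box_monomials_def l in_keys_iff split: if_splits)
    qed
  qed
  note bij = this
  show "finite (box_monomials Y d)"
    using bij_betw_finite[OF bij] assms by (simp add: finite_PiE)
  show "card (box_monomials Y d) = (d + 1) ^ card Y"
    using bij_betw_same_card[OF bij] assms by (simp add: card_PiE)
qed

lemma box_polys_mono: "d \<le> e \<Longrightarrow> box_polys Y d \<subseteq> box_polys Y e"
proof -
  assume "d \<le> e"
  then have "box_monomials Y d \<subseteq> box_monomials Y e"
    by (auto simp: box_monomials_def intro: order_trans)
  then show ?thesis by (auto simp: box_polys_def)
qed

lemma box_polys_1: "1 \<in> box_polys Y d"
  by (auto simp: box_polys_def box_monomials_def)

lemma box_polys_mult:
  assumes "p \<in> box_polys Y d" "q \<in> box_polys Y e"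
  shows "p * q \<in> box_polys Y (d + e)"
  unfolding box_polys_def
proof (intro CollectI subsetI)
  fix \<mu> assume "\<mu> \<in> Poly_Mapping.keys (p * q)"
  then obtain a b where ab: "\<mu> = a + b" "a \<in> Poly_Mapping.keys p" "b \<in> Poly_Mapping.keys q"
    using keys_mult[of p q] by blast
  then have "a \<in> box_monomials Y d" "b \<in> box_monomials Y e"
    using assms by (auto simp: box_polys_def)
  then show "\<mu> \<in> box_monomials Y (d + e)"
    using Poly_Mapping.keys_add[of a b]
    by (auto simp: ab(1) box_monomials_def lookup_add intro: add_mono)
qed

lemma box_polys_power: "p \<in> box_polys Y d \<Longrightarrow> p ^ e \<in> box_polys Y (d * e)"
  by (induction e) (auto simp: box_polys_1 intro: box_polys_mult)

lemma box_polys_prod: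
  assumes "\<And>i. i \<in> I \<Longrightarrow> f i \<in> box_polys Y (d i)"
  shows "(\<Prod>i\<in>I. f i) \<in> box_polys Y (\<Sum>i\<in>I. d i)"
  using assms
  by (induction I rule: infinite_finite_induct) (auto simp: box_polys_1 intro: box_polys_mult)

lemma exists_box:
  assumes "vars p \<subseteq> Y"
  shows "\<exists>d. p \<in> box_polys Y d"
proof -
  define d where "d = (\<Sum>\<mu>\<in>Poly_Mapping.keys p. \<Sum>v\<in>Poly_Mapping.keys \<mu>. Poly_Mapping.lookup \<mu> v)"
  have "Poly_Mapping.lookup \<mu> v \<le> d" if \<mu>: "\<mu> \<in> Poly_Mapping.keys p" for \<mu> v
  proof (cases "v \<in> Poly_Mapping.keys \<mu>")
    case True
    then have "Poly_Mapping.lookup \<mu> v \<le> (\<Sum>v\<in>Poly_Mapping.keys \<mu>. Poly_Mapping.lookup \<mu> v)"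
      by (intro member_le_sum) auto
    also have "\<dots> \<le> d" unfolding d_def
      using member_le_sum[OF \<mu>, of "\<lambda>\<mu>. \<Sum>v\<in>Poly_Mapping.keys \<mu>. Poly_Mapping.lookup \<mu> v"] by simp
    finally show ?thesis .
  qed (simp add: in_keys_iff)
  then have "p \<in> box_polys Y d"
    using assms by (auto simp: box_polys_def box_monomials_def vars_def)
  then show ?thesis ..
qed

lemma exists_common_box:
  assumes "finite P" "\<And>p. p \<in> P \<Longrightarrow> vars p \<subseteq> Y"
  shows "\<exists>d. P \<subseteq> box_polys Y d"
  using assms
proof (induction P rule: finite_induct)
  case (insert p P)
  then obtain d where d: "P \<subseteq> box_polys Y d" by auto
  obtain e where e: "p \<in> box_polys Y e" using insert.prems exists_box[of p Y] by auto
  have "insert p P \<subseteq> box_polys Y (max d e)"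
    using d e box_polys_mono[of d "max d e" Y] box_polys_mono[of e "max d e" Y] by auto
  then show ?case ..
qed simp

lemma lookup_Const_mult: "Poly_Mapping.lookup (Const c * p) \<mu> = c * Poly_Mapping.lookup p \<mu>"
  by (simp add: Const_def mult_map_scale_conv_mult[symmetric] Poly_Mapping.map.rep_eq when_def)

text \<open>Modulo the ideal, multiplying by powers of \<open>\<delta>\<close> turns every monomial in \<open>\<Omega>\<close> into a polynomial in
  the fewer variables \<open>Y\<close> of degree at most linear in its own degree; so there are too many
  monomials for all of them to stay linearly independent.\<close>

lemma exists_annihilated_poly:
  fixes \<delta> :: "(nat \<times> nat, 'k::field) mpoly"
  assumes Y: "Y \<subseteq> {..<m} \<times> {..<n}" and \<Omega>: "\<Omega> \<subseteq> {..<m} \<times> {..<n}"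
    and less: "card Y < card \<Omega>"
    and \<delta>: "vars \<delta> \<subseteq> Y"
    and ex: "\<And>v. v \<in> \<Omega> \<Longrightarrow> \<exists>g. vars g \<subseteq> Y \<and> \<delta> * Var v - g \<in> det_ideal s m n"
  shows "\<exists>p D. p \<noteq> 0 \<and> vars p \<subseteq> \<Omega> \<and> \<delta> ^ D * p \<in> det_ideal s m n"
proof -
  let ?V = "{..<m} \<times> {..<n}"
  define I where "I = (det_ideal s m n :: (nat \<times> nat, 'k) mpoly set)"
  have finY: "finite Y" and fin\<Omega>: "finite \<Omega>" using Y \<Omega> by (auto intro: finite_subset)
  obtain g where g: "\<And>v. v \<in> \<Omega> \<Longrightarrow> vars (g v) \<subseteq> Y" "\<And>v. v \<in> \<Omega> \<Longrightarrow> \<delta> * Var v - g v \<in> I"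
    using ex unfolding I_def by metis
  have "vars p \<subseteq> Y" if "p \<in> insert \<delta> (g ` \<Omega>)" for p using that g(1) \<delta> by blast
  \<comment> \<open>\<open>c\<close> bounds all exponents in \<open>\<delta>\<close> and in the
    finitely many \<open>g v\<close>.\<close>
  then obtain c where "insert \<delta> (g ` \<Omega>) \<subseteq> box_polys Y c"
    using exists_common_box[of "insert \<delta> (g ` \<Omega>)" Y] fin\<Omega> by blast
  then have c: "\<delta> \<in> box_polys Y c" "\<And>v. v \<in> \<Omega> \<Longrightarrow> g v \<in> box_polys Y c" by auto
  define K where "K = card \<Omega>"
  \<comment> \<open>With this \<open>e\<close>, \<open>(c * D + 1) ^ card Y\<close> is at most
    \<open>((c * K + 1) * (e + 1)) ^ card Y = e * (e + 1) ^ card Y\<close>, which is less than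
    \<open>(e + 1) ^ card \<Omega>\<close>: the monomials in \<open>\<Omega>\<close> outnumber those
    in \<open>Y\<close>. \<open>D\<close> bounds the total degree of the former.\<close>
  define e where "e = (c * K + 1) ^ card Y"
  define D where "D = e * K"
  define deg where "deg \<mu> = (\<Sum>v\<in>\<Omega>. Poly_Mapping.lookup \<mu> v)" for \<mu> :: "nat \<times> nat \<Rightarrow>\<^sub>0 nat"
  define h where "h \<mu> = \<delta> ^ (D - deg \<mu>) * (\<Prod>v\<in>\<Omega>. g v ^ Poly_Mapping.lookup \<mu> v)" for \<mu>
  let ?M = "box_monomials \<Omega> e"
  have deg_le: "deg \<mu> \<le> D" if "\<mu> \<in> ?M" for \<mu>
    unfolding deg_def D_def K_def using that sum_bounded_above[of \<Omega> "Poly_Mapping.lookup \<mu>" e]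
    by (auto simp: box_monomials_def mult.commute)
  have h_box: "h \<mu> \<in> box_polys Y (c * D)" if "\<mu> \<in> ?M" for \<mu>
  proof -
    have "h \<mu> \<in> box_polys Y (c * (D - deg \<mu>) + (\<Sum>v\<in>\<Omega>. c * Poly_Mapping.lookup \<mu> v))"
      unfolding h_def by (intro box_polys_mult box_polys_power box_polys_prod c)
    also have "c * (D - deg \<mu>) + (\<Sum>v\<in>\<Omega>. c * Poly_Mapping.lookup \<mu> v) = c * D"
      using deg_le[OF that] by (simp add: deg_def flip: sum_distrib_left distrib_left)
    finally show ?thesis .
  qed
  have "card (box_monomials Y (c * D)) < card ?M"
  proof -
    have "c * D + 1 \<le> (c * K + 1) * (e + 1)" by (simp add: D_def algebra_simps)
    then have "(c * D + 1) ^ card Y \<le> ((c * K + 1) * (e + 1)) ^ card Y" by (rule power_mono) simp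
    also have "\<dots> = e * (e + 1) ^ card Y" by (simp only: power_mult_distrib e_def[symmetric])
    also have "\<dots> < (e + 1) ^ Suc (card Y)" by simp
    also have "\<dots> \<le> (e + 1) ^ card \<Omega>" using less by (intro power_increasing) auto
    finally show ?thesis by (simp add: card_box_monomials finY fin\<Omega>)
  qed
  \<comment> \<open>One unknown for each monomial in \<open>\<Omega>\<close>, one equation for each
    possible coefficient of the \<open>h \<mu>\<close>: a solution is a linear dependence of the
    \<open>h \<mu>\<close>.\<close>
  then obtain a where a: "\<exists>\<mu>\<in>?M. a \<mu> \<noteq> 0"
    "\<forall>\<nu>\<in>box_monomials Y (c * D). (\<Sum>\<mu>\<in>?M. a \<mu> * Poly_Mapping.lookup (h \<mu>) \<nu>) = 0"
    using homogeneous_system[of "box_monomials Y (c * D)" ?M "\<lambda>\<mu>. Poly_Mapping.lookup (h \<mu>)"]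
      card_box_monomials(1) finY fin\<Omega> by blast
  have sum0: "(\<Sum>\<mu>\<in>?M. Const (a \<mu>) * h \<mu>) = 0"
  proof (rule poly_mapping_eqI)
    fix \<nu>
    show "Poly_Mapping.lookup (\<Sum>\<mu>\<in>?M. Const (a \<mu>) * h \<mu>) \<nu> = Poly_Mapping.lookup 0 \<nu>"
    proof (cases "\<nu> \<in> box_monomials Y (c * D)")
      case True
      then show ?thesis using a(2) by (simp add: lookup_sum lookup_Const_mult)
    next
      case False
      then have "Poly_Mapping.lookup (h \<mu>) \<nu> = 0" if "\<mu> \<in> ?M" for \<mu>
        using h_box[OF that] by (auto simp: box_polys_def in_keys_iff)
      then show ?thesis by (simp add: lookup_sum lookup_Const_mult)
    qed
  qed
  define p where "p = (\<Sum>\<mu>\<in>?M. Const (a \<mu>) * mon_eval Var \<mu>)"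
  have p_lookup: "Poly_Mapping.lookup p \<mu> = a \<mu>" if "\<mu> \<in> ?M" for \<mu>
    using that card_box_monomials(1)[OF fin\<Omega>]
    by (simp add: p_def lookup_sum lookup_Const_mult mon_eval_Var lookup_single when_def if_distrib cong: if_cong)
  have VarV: "vars (Var v :: (nat \<times> nat, 'k) mpoly) \<subseteq> W" if "v \<in> W" for v W
    using vars_Var[of v] that by blast
  have \<delta>V: "vars (\<delta> ^ d) \<subseteq> ?V" for d
    using \<delta> Y by (intro vars_power_subset) auto
  have gV: "vars (g v) \<subseteq> ?V" if "v \<in> \<Omega>" for v using g(1)[OF that] Y by auto
  have cong_mult: "p * q - p' * q' \<in> I"
    if "p - p' \<in> I" "q - q' \<in> I" "vars p \<subseteq> ?V" "vars q' \<subseteq> ?V" for p q p' q'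
  proof -
    have "p * q - p' * q' = p * (q - q') + q' * (p - p')" by (simp add: algebra_simps)
    then show ?thesis using that unfolding I_def by (simp add: det_ideal_add det_ideal_mult)
  qed
  have cong_power: "p ^ d - q ^ d \<in> I" if "p - q \<in> I" "vars p \<subseteq> ?V" "vars q \<subseteq> ?V" for p q d
    using that
    by (induction d) (simp_all add: cong_mult vars_power_subset, simp add: I_def det_ideal_0)
  have cong_prod: "(\<Prod>v\<in>S. P v) - (\<Prod>v\<in>S. Q v) \<in> I"
    if "\<And>v. v \<in> S \<Longrightarrow> P v - Q v \<in> I" "\<And>v. v \<in> S \<Longrightarrow> vars (P v) \<subseteq> ?V"
      "\<And>v. v \<in> S \<Longrightarrow> vars (Q v) \<subseteq> ?V" for S :: "(nat \<times> nat) set" and P Q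
    using that
    by (induction S rule: infinite_finite_induct)
      (simp_all add: cong_mult vars_prod_subset, simp_all add: I_def det_ideal_0)
  have key: "\<delta> ^ D * mon_eval Var \<mu> - h \<mu> \<in> I" if "\<mu> \<in> ?M" for \<mu>
  proof -
    have "mon_eval Var \<mu> = (\<Prod>v\<in>\<Omega>. Var v ^ Poly_Mapping.lookup \<mu> v :: (nat \<times> nat, 'k) mpoly)"
      using that fin\<Omega> by (intro mon_eval_superset) (auto simp: box_monomials_def)
    moreover have "\<delta> ^ D = \<delta> ^ (D - deg \<mu>) * (\<Prod>v\<in>\<Omega>. \<delta> ^ Poly_Mapping.lookup \<mu> v)"
      using deg_le[OF that] by (simp add: deg_def flip: power_sum power_add)
    ultimately have "\<delta> ^ D * mon_eval Var \<mu> - h \<mu> =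
        \<delta> ^ (D - deg \<mu>) * ((\<Prod>v\<in>\<Omega>. (\<delta> * Var v) ^ Poly_Mapping.lookup \<mu> v) -
          (\<Prod>v\<in>\<Omega>. g v ^ Poly_Mapping.lookup \<mu> v))"
      by (simp add: h_def prod.distrib power_mult_distrib algebra_simps)
    moreover have "(\<Prod>v\<in>\<Omega>. (\<delta> * Var v) ^ Poly_Mapping.lookup \<mu> v) -
          (\<Prod>v\<in>\<Omega>. g v ^ Poly_Mapping.lookup \<mu> v) \<in> I"
    proof (rule cong_prod)
      fix v assume v: "v \<in> \<Omega>"
      have \<delta>v: "vars (\<delta> * Var v) \<subseteq> ?V"
        using VarV[of v ?V] \<Omega> v \<delta>V[of 1] by (intro vars_mult_subset) auto
      show "(\<delta> * Var v) ^ Poly_Mapping.lookup \<mu> v - g v ^ Poly_Mapping.lookup \<mu> v \<in> I"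
        using g(2) v \<delta>v gV by (intro cong_power) auto
      show "vars ((\<delta> * Var v) ^ Poly_Mapping.lookup \<mu> v) \<subseteq> ?V"
        "vars (g v ^ Poly_Mapping.lookup \<mu> v) \<subseteq> ?V"
        using \<delta>v gV v by (simp_all add: vars_power_subset)
    qed
    ultimately show ?thesis using \<delta>V by (simp add: I_def det_ideal_mult)
  qed
  have "p \<noteq> 0" using a(1) p_lookup by fastforce
  moreover have "vars p \<subseteq> \<Omega>"
    unfolding p_def mon_eval_def
    by (intro vars_sum_subset vars_mult_subset vars_prod_subset vars_power_subset VarV)
      (auto simp: box_monomials_def)
  moreover have "\<delta> ^ D * p \<in> I"
  proof -
    \<comment> \<open>The subtracted sum is zero, and pairing it term by term with \<open>p\<close>
      leaves a combination of the congruences \<open>key\<close>.\<close>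
    have "\<delta> ^ D * p = \<delta> ^ D * p - (\<Sum>\<mu>\<in>?M. Const (a \<mu>) * h \<mu>)" by (simp add: sum0)
    also have "\<dots> = (\<Sum>\<mu>\<in>?M. Const (a \<mu>) * (\<delta> ^ D * mon_eval Var \<mu> - h \<mu>))"
      by (simp add: p_def sum_distrib_left algebra_simps sum_subtractf)
    also have "\<dots> \<in> I"
      using key unfolding I_def by (intro det_ideal_sum det_ideal_mult) auto
    finally show ?thesis .
  qed
  ultimately show ?thesis unfolding I_def by blast
qed

section \<open>Bordered minors and their expansion\<close>

lemma card_less_insert:
  "finite A \<Longrightarrow> i \<notin> A \<Longrightarrow> card {x \<in> insert i A. x < y} = (if i < y then Suc (card {x\<in>A. x < y}) else card {x\<in>A. x < y})"
proof -
  assume *: "finite A" "i \<notin> A"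
  have "{x \<in> insert i A. x < y} = (if i < y then insert i {x\<in>A. x < y} else {x\<in>A. x < y})"
    by auto
  then show ?thesis using * by auto
qed

text \<open>Elements of \<open>A\<close> below \<open>i\<close> keep their position in the
  increasing enumeration and those above move up by one; this is the index shift that
  \<open>mat_delete\<close> performs.\<close>

lemma pick_insert:
  assumes "finite A" "i \<notin> A" "x < card A"
  shows "pick (insert i A) (if x < card {y\<in>A. y < i} then x else Suc x) = pick A x"
proof -
  define y where "y = pick A x"
  have y: "y \<in> A" "card {z\<in>A. z < y} = x"
    using assms by (auto simp: y_def pick_in_set_le card_pick_le)
  have "y \<noteq> i" using y assms by auto
  have "x < card {z\<in>A. z < i} \<longleftrightarrow> y < i"
  proof
    assume "y < i"
    then have "{z\<in>A. z < y} \<subset> {z\<in>A. z < i}" using y by auto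
    then show "x < card {z\<in>A. z < i}" using y(2) assms(1) psubset_card_mono[of "{z\<in>A. z < i}"] by auto
  next
    assume *: "x < card {z\<in>A. z < i}"
    show "y < i"
    proof (rule ccontr)
      assume "\<not> y < i"
      then have "card {z\<in>A. z < i} \<le> card {z\<in>A. z < y}" using assms(1) by (intro card_mono) auto
      then show False using * y by simp
    qed
  qed
  then have "(if x < card {y\<in>A. y < i} then x else Suc x) = card {z \<in> insert i A. z < y}"
    using \<open>y \<noteq> i\<close> y card_less_insert[OF assms(1,2), of y] by (auto split: if_splits)
  then show ?thesis using y pick_card_in_set[of y "insert i A"] by (simp add: y_def)
qed

text \<open>The two counts are the positions of row \<open>i\<close> and column \<open>j\<close> in
  the bordered submatrix, so the cofactor at that entry is the minor on \<open>A\<close> and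
  \<open>B\<close> up to sign.\<close>

lemma mat_delete_generic_submatrix:
  assumes A: "A \<subseteq> {..<m}" "card A = s" "i < m" "i \<notin> A"
    and B: "B \<subseteq> {..<n}" "card B = s" "j < n" "j \<notin> B"
  defines "Z \<equiv> generic_matrix m n :: (nat \<times> nat, 'k::comm_ring_1) mpoly mat"
  shows "mat_delete (submatrix Z (insert i A) (insert j B))
      (card {x\<in>A. x < i}) (card {x\<in>B. x < j}) = submatrix Z A B"
proof (rule eq_matI)
  have fin: "finite A" "finite B" using A B by (auto intro: finite_subset)
  have car: "submatrix Z (insert i A) (insert j B) \<in> carrier_mat (Suc s) (Suc s)"
    using A B fin by (unfold Z_def, intro generic_submatrix_dims) auto
  have car': "submatrix Z A B \<in> carrier_mat s s"
    using A B by (unfold Z_def, intro generic_submatrix_dims)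
  let ?a = "card {x\<in>A. x < i}" and ?b = "card {x\<in>B. x < j}"
  fix x y assume "x < dim_row (submatrix Z A B)"
    "y < dim_col (submatrix Z A B)"
  then have xy: "x < s" "y < s" using car' by auto
  show "mat_delete (submatrix Z (insert i A) (insert j B)) ?a ?b $$ (x, y) =
      submatrix Z A B $$ (x, y)"
  proof -
    define x' y' where "x' = (if x < ?a then x else Suc x)" and "y' = (if y < ?b then y else Suc y)"
    have "mat_delete (submatrix Z (insert i A) (insert j B)) ?a ?b $$ (x, y) =
        submatrix Z (insert i A) (insert j B) $$ (x', y')"
      using xy carrier_matD[OF car] by (simp add: mat_delete_def x'_def y'_def)
    also have "\<dots> = Var (pick (insert i A) x', pick (insert j B) y')"
      using xy A B fin by (unfold Z_def, intro generic_submatrix_entry) (auto simp: x'_def y'_def)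
    also have "\<dots> = Var (pick A x, pick B y)"
      using xy A B fin pick_insert[of A i x] pick_insert[of B j y] by (simp add: x'_def y'_def)
    also have "\<dots> = submatrix Z A B $$ (x, y)"
      using xy A B by (unfold Z_def, intro generic_submatrix_entry[symmetric]) auto
    finally show ?thesis .
  qed
next
  have fin: "finite A" "finite B" using A B by (auto intro: finite_subset)
  have "submatrix Z (insert i A) (insert j B) \<in> carrier_mat (Suc s) (Suc s)"
    using A B fin by (unfold Z_def, intro generic_submatrix_dims) auto
  moreover have "submatrix Z A B \<in> carrier_mat s s"
    using A B by (unfold Z_def, intro generic_submatrix_dims)
  ultimately show
    "dim_row (mat_delete (submatrix Z (insert i A) (insert j B))
      (card {x\<in>A. x < i}) (card {x\<in>B. x < j})) = dim_row (submatrix Z A B)"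
    "dim_col (mat_delete (submatrix Z (insert i A) (insert j B))
      (card {x\<in>A. x < i}) (card {x\<in>B. x < j})) = dim_col (submatrix Z A B)"
    by simp_all
qed

lemma pick_neq:
  assumes "finite A" "x < card A" "i \<in> A" "x \<noteq> card {y\<in>A. y < i}"
  shows "pick A x \<in> A - {i}"
  using assms card_pick_le[of x A] pick_in_set_le[of x A] by auto

text \<open>Expand the \<open>(s+1)\<close>-minor on the rows \<open>A \<union> {i}\<close> and columns \<open>B \<union> {j}\<close> along row \<open>i\<close>.\<close>

lemma minor_times_Var:
  fixes m n :: nat
  assumes A: "A \<subseteq> {..<m}" "card A = s" and B: "B \<subseteq> {..<n}" "card B = s"
    and ij: "i < m" "j < n"
  defines "Y \<equiv> A \<times> {..<n} \<union> {..<m} \<times> B"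
  shows "\<exists>g :: (nat \<times> nat, 'k::field) mpoly. vars g \<subseteq> Y \<and>
    det (submatrix (generic_matrix m n) A B) * Var (i, j) - g \<in> det_ideal (s + 1) m n"
proof -
  define \<delta> where "\<delta> = (det (submatrix (generic_matrix m n) A B) :: (nat \<times> nat, 'k) mpoly)"
  have VarY: "vars (Var v :: (nat \<times> nat, 'k) mpoly) \<subseteq> W" if "v \<in> W" for v W
    using vars_Var[of v] that by blast
  have \<delta>Y: "vars \<delta> \<subseteq> Y"
    using vars_generic_minor[OF A(1) B(1) A(2) B(2)] A B unfolding \<delta>_def Y_def by blast
  show ?thesis
  proof (cases "i \<in> A \<or> j \<in> B")
    case True
    then have "vars (\<delta> * Var (i, j)) \<subseteq> Y"
      using ij \<delta>Y by (intro vars_mult_subset VarY) (auto simp: Y_def)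
    then show ?thesis
      unfolding \<delta>_def[symmetric] by (intro exI[of _ "\<delta> * Var (i, j)"]) (simp add: det_ideal_0)
  next
    case False
    have fin: "finite A" "finite B" using A B by (auto intro: finite_subset)
    let ?A = "insert i A" and ?B = "insert j B"
    have AB: "?A \<subseteq> {..<m}" "?B \<subseteq> {..<n}" "card ?A = Suc s" "card ?B = Suc s"
      using A B ij False fin by auto
    define M where "M = (submatrix (generic_matrix m n) ?A ?B :: (nat \<times> nat, 'k) mpoly mat)"
    have car: "M \<in> carrier_mat (Suc s) (Suc s)"
      unfolding M_def by (rule generic_submatrix_dims[OF AB])
    have entry: "M $$ (x, y) = Var (pick ?A x, pick ?B y)" if "x < Suc s" "y < Suc s" for x y
      unfolding M_def using that AB by (intro generic_submatrix_entry) auto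
    define a b where "a = card {x\<in>A. x < i}" and "b = card {x\<in>B. x < j}"
    have ai: "a = card {x\<in>?A. x < i}" "b = card {x\<in>?B. x < j}"
      using card_less_insert[OF fin(1), of i i] card_less_insert[OF fin(2), of j j] False
      by (simp_all add: a_def b_def)
    have ab: "a < Suc s" "b < Suc s"
      using card_mono[of A "{x\<in>A. x < i}"] card_mono[of B "{x\<in>B. x < j}"] fin A B
      by (auto simp: a_def b_def)
    have picks: "pick ?A a = i" "pick ?B b = j"
      using pick_card_in_set[of i ?A] pick_card_in_set[of j ?B] by (simp_all add: ai)
    have cof: "cofactor M a b = (- 1) ^ (a + b) * \<delta>"
      using mat_delete_generic_submatrix[where 'k = 'k, of A m s i B n j] A B ij False
      by (simp add: cofactor_def M_def a_def b_def \<delta>_def)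
    \<comment> \<open>\<open>g\<close> is minus the rest of the expansion, multiplied by the sign of
      the cofactor at row \<open>i\<close> and column \<open>j\<close>, so that
      \<open>\<delta> * Var (i, j) - g\<close> is \<open>det M\<close> up to sign.\<close>
    define g where "g = - ((- 1) ^ (a + b) * (\<Sum>y\<in>{..<Suc s} - {b}. M $$ (a, y) * cofactor M a y))"
    have "det M = (\<Sum>y<Suc s. M $$ (a, y) * cofactor M a y)"
      by (rule laplace_expansion_row[OF car ab(1)])
    also have "\<dots> = M $$ (a, b) * cofactor M a b + (\<Sum>y\<in>{..<Suc s} - {b}. M $$ (a, y) * cofactor M a y)"
      using ab by (subst sum.remove[of _ b]) auto
    finally have "(- 1) ^ (a + b) * det M = \<delta> * Var (i, j) - g"
      using ab by (simp add: g_def cof entry picks algebra_simps flip: mult.assoc power_add mult_2_right)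
    moreover have "det M \<in> det_ideal (s + 1) m n"
      using AB by (intro det_ideal_gen) (auto simp: generic_minors_def M_def)
    moreover have sgn: "vars ((- 1) ^ (a + b) :: (nat \<times> nat, 'k) mpoly) \<subseteq> W" for W
      by (rule vars_power_subset) simp
    ultimately have "\<delta> * Var (i, j) - g \<in> det_ideal (s + 1) m n"
      using det_ideal_mult[of "det M" "s + 1" m n "(- 1) ^ (a + b)"] by simp
    moreover have "vars g \<subseteq> Y"
      unfolding g_def vars_uminus
    proof (intro vars_mult_subset[OF sgn] vars_sum_subset vars_mult_subset)
      fix y assume y: "y \<in> {..<Suc s} - {b}"
      \<comment> \<open>Row \<open>i\<close> away from column \<open>j\<close> meets only columns in
        \<open>B\<close>; the cofactors treated next omit row \<open>i\<close>, so their variables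
        lie in rows from \<open>A\<close>. Both kinds belong to \<open>Y\<close>.\<close>
      have "pick ?B y \<in> ?B - {j}" using y AB fin ai by (intro pick_neq) auto
      then show "vars (M $$ (a, y)) \<subseteq> Y"
        using y ab ij by (subst entry) (auto intro!: VarY simp: picks Y_def)
      have "vars (det (mat_delete M a y)) \<subseteq> Y"
      proof (rule vars_det_subset)
        show "mat_delete M a y \<in> carrier_mat s s" using car by (simp add: mat_delete_def)
        fix x z assume xz: "x < s" "z < s"
        define x' where "x' = (if x < a then x else Suc x)"
        define z' where "z' = (if z < y then z else Suc z)"
        have "x' < Suc s" "z' < Suc s" "x' \<noteq> a" using xz by (auto simp: x'_def z'_def)
        moreover from this have "pick ?A x' \<in> ?A - {i}" using AB fin ai by (intro pick_neq) auto
        moreover have "pick ?B z' < n" using AB \<open>z' < Suc s\<close> pick_in_set_le[of z' ?B] by auto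
        moreover have "mat_delete M a y $$ (x, z) = M $$ (x', z')"
          using xz car by (simp add: mat_delete_def x'_def z'_def)
        ultimately show "vars (mat_delete M a y $$ (x, z)) \<subseteq> Y"
          by (auto simp: entry Y_def intro!: VarY)
      qed
      then show "vars (cofactor M a y) \<subseteq> Y"
        unfolding cofactor_def
        by (intro vars_mult_subset vars_power_subset) auto
    qed
    ultimately show ?thesis unfolding \<delta>_def by blast
  qed
qed

text \<open>The polynomials with a power that carries \<open>p\<close> into
  \<open>det_ideal t m n\<close> form the radical of a colon ideal. Being an ideal, it contains
  \<open>det_ideal s m n\<close> once it contains the minors.\<close>

lemma power_mult_mem_det_ideal:
  fixes p :: "(nat \<times> nat, 'k::field) mpoly"
  assumes p: "vars p \<subseteq> {..<m} \<times> {..<n}"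
    and ann: "\<And>\<delta>. \<delta> \<in> generic_minors s m n \<Longrightarrow> \<exists>D. \<delta> ^ D * p \<in> det_ideal t m n"
    and q: "q \<in> det_ideal s m n"
  shows "\<exists>D. q ^ D * p \<in> det_ideal t m n"
proof -
  let ?V = "{..<m} \<times> {..<n}"
  define K where "K = {q. vars q \<subseteq> ?V \<and> (\<exists>D. q ^ D * p \<in> det_ideal t m n)}"
  have larger: "q ^ E * p \<in> det_ideal t m n"
    if "q ^ D * p \<in> det_ideal t m n" "vars q \<subseteq> ?V" "D \<le> E" for q :: "(nat \<times> nat, 'k) mpoly" and D E
  proof -
    have "q ^ E = q ^ (E - D) * q ^ D" using that(3) by (simp flip: power_add)
    then have eq: "q ^ E * p = q ^ (E - D) * (q ^ D * p)" by (simp only: mult.assoc)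
    show ?thesis unfolding eq by (intro det_ideal_mult[OF that(1)] vars_power_subset that)
  qed
  have "det_ideal s m n \<subseteq> K"
  proof (rule det_ideal_minimal)
    show "0 \<in> K" by (auto simp: K_def det_ideal_0 intro: exI[of _ 1])
    show "generic_minors s m n \<subseteq> K"
      using ann generic_minors_subset[of s m n] by (auto simp: K_def poly_ring_def)
    fix a b :: "(nat \<times> nat, 'k) mpoly"
    {
      assume b: "b \<in> K" and a: "vars a \<subseteq> ?V"
      then obtain D where D: "b ^ D * p \<in> det_ideal t m n" by (auto simp: K_def)
      have "a ^ D * (b ^ D * p) \<in> det_ideal t m n"
        by (intro det_ideal_mult[OF D] vars_power_subset a)
      then have "(a * b) ^ D * p \<in> det_ideal t m n"
        by (simp only: power_mult_distrib mult.assoc)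
      moreover have "vars (a * b) \<subseteq> ?V"
        using a b by (intro vars_mult_subset) (simp_all add: K_def)
      ultimately show "a * b \<in> K" unfolding K_def by blast
    }
    assume "a \<in> K" "b \<in> K"
    then obtain D E where DE: "a ^ D * p \<in> det_ideal t m n" "b ^ E * p \<in> det_ideal t m n"
      and V: "vars a \<subseteq> ?V" "vars b \<subseteq> ?V" by (auto simp: K_def)
    \<comment> \<open>In each binomial term either the exponent of \<open>a\<close> is at least
      \<open>D\<close> or that of \<open>b\<close> is at least \<open>E\<close>.\<close>
    have "(a + b) ^ (D + E) * p =
        (\<Sum>k\<le>D + E. of_nat ((D + E) choose k) * (a ^ k * b ^ (D + E - k) * p))"
      unfolding binomial_ring sum_distrib_right by (intro sum.cong refl) (simp add: algebra_simps)
    also have "\<dots> \<in> det_ideal t m n"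
    proof (rule det_ideal_sum, rule det_ideal_mult)
      fix k assume "k \<in> {..D + E}"
      show "a ^ k * b ^ (D + E - k) * p \<in> det_ideal t m n"
      proof (cases "D \<le> k")
        case True
        then have "b ^ (D + E - k) * (a ^ k * p) \<in> det_ideal t m n"
          using larger[OF DE(1)] V by (simp add: det_ideal_mult vars_power_subset)
        then show ?thesis by (simp add: algebra_simps)
      next
        case False
        then have "a ^ k * (b ^ (D + E - k) * p) \<in> det_ideal t m n"
          using larger[OF DE(2)] V by (simp add: det_ideal_mult vars_power_subset)
        then show ?thesis by (simp add: algebra_simps)
      qed
      show "vars (of_nat ((D + E) choose k)) \<subseteq> ?V"
        by (rule vars_of_nat_subset)
    qed
    finally show "a + b \<in> K" using V by (auto simp: K_def vars_add_subset)
  qed (auto simp: K_def)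
  then show ?thesis using q by (auto simp: K_def)
qed

lemma finite_generic_minors: "finite (generic_minors s m n)"
proof -
  have "generic_minors s m n \<subseteq>
      (\<lambda>(A, B). det (submatrix (generic_matrix m n) A B)) ` (Pow {..<m} \<times> Pow {..<n})"
    by (auto simp: generic_minors_def)
  then show ?thesis by (rule finite_subset) auto
qed

text \<open>Induction on the size \<open>s\<close> of the minors up to \<open>r + 1\<close>: the
  polynomials belonging to the individual minors are multiplied into one \<open>P\<close>, which
  serves all minors and hence, by \<open>power_mult_mem_det_ideal\<close>, the given
  \<open>q\<close>.\<close>

lemma exists_poly_in_det_ideal:
  assumes \<Omega>: "\<Omega> \<subseteq> {..<m} \<times> {..<n}" and r: "r \<le> m" "r \<le> n"
    and card: "r * (m + n - r) < card \<Omega>"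
  shows "\<exists>q :: (nat \<times> nat, 'k::field) mpoly. q \<noteq> 0 \<and> vars q \<subseteq> \<Omega> \<and> q \<in> det_ideal (r + 1) m n"
proof -
  let ?V = "{..<m} \<times> {..<n}"
  have "\<exists>q :: (nat \<times> nat, 'k) mpoly. q \<noteq> 0 \<and> vars q \<subseteq> \<Omega> \<and> q \<in> det_ideal s m n" if "s \<le> r + 1" for s
    using that
  proof (induction s)
    case 0
    \<comment> \<open>The empty minor is \<open>1\<close>, so the induction starts from the unit
      ideal.\<close>
    have "det (submatrix (generic_matrix m n) {} {}) = (1 :: (nat \<times> nat, 'k) mpoly)"
      by (intro det_dim_zero generic_submatrix_dims) auto
    then have "(1 :: (nat \<times> nat, 'k) mpoly) \<in> det_ideal 0 m n"
      by (intro det_ideal_gen) (force simp: generic_minors_def)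
    then show ?case by (intro exI[of _ 1]) simp
  next
    case (Suc s)
    then obtain q :: "(nat \<times> nat, 'k) mpoly" where q: "q \<noteq> 0" "vars q \<subseteq> \<Omega>" "q \<in> det_ideal s m n"
      by auto
    have "\<exists>p D. p \<noteq> 0 \<and> vars p \<subseteq> \<Omega> \<and> \<delta> ^ D * p \<in> det_ideal (Suc s) m n"
      if "\<delta> \<in> generic_minors s m n" for \<delta> :: "(nat \<times> nat, 'k) mpoly"
    proof -
      obtain A B where AB: "A \<subseteq> {..<m}" "card A = s" "B \<subseteq> {..<n}" "card B = s"
        and \<delta>: "\<delta> = det (submatrix (generic_matrix m n) A B)"
        using \<open>\<delta> \<in> generic_minors s m n\<close> by (auto simp: generic_minors_def)
      define Y where "Y = A \<times> {..<n} \<union> {..<m} \<times> B"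
      have fin: "finite A" "finite B" using AB by (auto intro: finite_subset)
      have "card Y = s * n + m * s - s * s"
      proof -
        have "A \<times> {..<n} \<inter> {..<m} \<times> B = A \<times> B" using AB by auto
        then show ?thesis
          using card_Un_Int[of "A \<times> {..<n}" "{..<m} \<times> B"] fin AB by (simp add: Y_def)
      qed
      also have "\<dots> \<le> r * (m + n - r)"
      proof -
        have sr: "s \<le> r" using Suc by simp
        \<comment> \<open>The right side minus the left side factors as
          \<open>(r - s) * (m + n - r - s)\<close>.\<close>
        have "int s * int n + int m * int s - int s * int s \<le> int r * (int m + int n - int r)"
        proof -
          have "0 \<le> (int r - int s) * (int m + int n - int r - int s)"
            using sr r by (intro mult_nonneg_nonneg) auto
          then show ?thesis by (simp add: algebra_simps)
        qed
        moreover have "s * s \<le> s * n + m * s" using sr r by (simp add: trans_le_add1)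
        moreover have "r \<le> m + n" using r by simp
        ultimately have "int (s * n + m * s - s * s) \<le> int (r * (m + n - r))"
          by (simp add: of_nat_diff)
        then show ?thesis by (simp only: of_nat_le_iff)
      qed
      finally have "card Y < card \<Omega>" using card by simp
      moreover have "Y \<subseteq> ?V" using AB by (auto simp: Y_def)
      moreover have "vars \<delta> \<subseteq> Y"
        using vars_generic_minor[of A m B n s] AB unfolding \<delta> Y_def by blast
      moreover have "\<exists>g. vars g \<subseteq> Y \<and> \<delta> * Var v - g \<in> det_ideal (Suc s) m n" if "v \<in> \<Omega>" for v
        using minor_times_Var[of A m s B n "fst v" "snd v"] AB that \<Omega> unfolding \<delta> Y_def by auto
      ultimately show ?thesis using \<Omega> by (intro exists_annihilated_poly[of Y m n]) auto
    qed
    then obtain p D where pD: "\<And>\<delta> :: (nat \<times> nat, 'k) mpoly. \<delta> \<in> generic_minors s m n \<Longrightarrow>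
        p \<delta> \<noteq> 0 \<and> vars (p \<delta>) \<subseteq> \<Omega> \<and> \<delta> ^ D \<delta> * p \<delta> \<in> det_ideal (Suc s) m n"
      by metis
    define P where "P = (\<Prod>\<delta>\<in>generic_minors s m n. p \<delta>)"
    have P0: "P \<noteq> 0" unfolding P_def using pD finite_generic_minors by (intro mpoly_prod_nonzero) auto
    have PV: "vars P \<subseteq> \<Omega>" unfolding P_def using pD by (intro vars_prod_subset) auto
    have "\<exists>D. \<delta> ^ D * P \<in> det_ideal (Suc s) m n" if \<delta>: "\<delta> \<in> generic_minors s m n" for \<delta>
    proof -
      have "P = (\<Prod>\<delta>\<in>generic_minors s m n - {\<delta>}. p \<delta>) * p \<delta>"
        unfolding P_def using \<delta> finite_generic_minors by (subst prod.remove[of _ \<delta>]) auto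
      then have "\<delta> ^ D \<delta> * P = (\<Prod>\<delta>\<in>generic_minors s m n - {\<delta>}. p \<delta>) * (\<delta> ^ D \<delta> * p \<delta>)"
        by (simp add: algebra_simps)
      also have "\<dots> \<in> det_ideal (Suc s) m n"
      proof (rule det_ideal_mult)
        show "vars (\<Prod>\<delta>\<in>generic_minors s m n - {\<delta>}. p \<delta>) \<subseteq> ?V"
        proof (rule vars_prod_subset)
          fix \<eta> assume "\<eta> \<in> generic_minors s m n - {\<delta>}"
          then have "vars (p \<eta>) \<subseteq> \<Omega>" using pD[of \<eta>] by blast
          then show "vars (p \<eta>) \<subseteq> ?V" using \<Omega> by (rule order_trans)
        qed
      qed (use pD[OF \<delta>] in blast)
      finally show ?thesis ..
    qed
    moreover have "vars P \<subseteq> ?V" using PV \<Omega> by blast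
    ultimately obtain E where "q ^ E * P \<in> det_ideal (Suc s) m n"
      using power_mult_mem_det_ideal q(3) by blast
    moreover have "q ^ E * P \<noteq> 0" using q(1) P0 by simp
    moreover have "vars (q ^ E * P) \<subseteq> \<Omega>" using q(2) PV by (simp add: vars_mult_subset vars_power_subset)
    ultimately show ?case by blast
  qed
  then show ?thesis by auto
qed

section \<open>Hall's marriage theorem\<close>

text \<open>Induction on the size of \<open>P\<close>. If some proper nonempty subfamily is tight,
  it is matched first and the rest is matched off its union; otherwise every proper nonempty
  subfamily has an element to spare, and the value for one index may be fixed freely.\<close>

lemma hall_marriage:
  assumes "finite P" "\<And>\<rho>. \<rho> \<in> P \<Longrightarrow> finite (F \<rho>)"
    and "\<And>S. S \<subseteq> P \<Longrightarrow> card S \<le> card (\<Union>\<rho>\<in>S. F \<rho>)"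
  shows "\<exists>f. inj_on f P \<and> (\<forall>\<rho>\<in>P. f \<rho> \<in> F \<rho>)"
  using assms
proof (induction "card P" arbitrary: P F rule: less_induct)
  case less
  note finP = less.prems(1) and finF = less.prems(2) and cond = less.prems(3)
  have finU: "finite (\<Union>\<rho>\<in>S. F \<rho>)" if "S \<subseteq> P" for S
    using that finP finF by (auto intro: finite_subset)
  show ?case
  proof (cases "P = {}")
    case False
    show ?thesis
    proof (cases "\<exists>S. S \<subset> P \<and> S \<noteq> {} \<and> card S = card (\<Union>\<rho>\<in>S. F \<rho>)")
      case True
      then obtain S where S: "S \<subset> P" "S \<noteq> {}" "card S = card (\<Union>\<rho>\<in>S. F \<rho>)" by auto
      have finS: "finite S" using S finP by (auto intro: finite_subset)
      have "card S < card P" using S(1) by (rule psubset_card_mono[OF finP])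
      then have "\<exists>f. inj_on f S \<and> (\<forall>\<rho>\<in>S. f \<rho> \<in> F \<rho>)"
        using S(1) finS finF by (intro less.hyps cond) auto
      then obtain f where f: "inj_on f S" "\<forall>\<rho>\<in>S. f \<rho> \<in> F \<rho>" by blast
      define U where "U = (\<Union>\<rho>\<in>S. F \<rho>)"
      have "\<exists>f. inj_on f (P - S) \<and> (\<forall>\<rho>\<in>P - S. f \<rho> \<in> F \<rho> - U)"
      proof (rule less.hyps)
        have "0 < card S" using S(2) finS by (simp only: card_gt_0_iff) simp
        then show "card (P - S) < card P"
          using S finP finS card_mono[of P S] by (subst card_Diff_subset) auto
        fix T assume T: "T \<subseteq> P - S"
        \<comment> \<open>Hall's condition off \<open>U\<close>: apply the hypothesis to
          \<open>T \<union> S\<close> and subtract the tight count of \<open>S\<close>.\<close>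
        have "card T + card S = card (T \<union> S)"
          using T finP finS by (subst card_Un_disjoint) (auto intro: finite_subset)
        also have "\<dots> \<le> card (\<Union>\<rho>\<in>T \<union> S. F \<rho>)" using T S by (intro cond) auto
        also have "(\<Union>\<rho>\<in>T \<union> S. F \<rho>) = (\<Union>\<rho>\<in>T. F \<rho> - U) \<union> U" by (auto simp: U_def)
        also have "card \<dots> \<le> card (\<Union>\<rho>\<in>T. F \<rho> - U) + card U" by (rule card_Un_le)
        finally show "card T \<le> card (\<Union>\<rho>\<in>T. F \<rho> - U)" using S by (simp add: U_def)
      qed (use finP finF in auto)
      then obtain h where h: "inj_on h (P - S)" "\<forall>\<rho>\<in>P - S. h \<rho> \<in> F \<rho> - U" by blast
      define k where "k \<rho> = (if \<rho> \<in> S then f \<rho> else h \<rho>)" for \<rho>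
      have "inj_on k P"
      proof (rule inj_onI)
        fix \<rho> \<sigma> assume *: "\<rho> \<in> P" "\<sigma> \<in> P" "k \<rho> = k \<sigma>"
        have fU: "f \<rho> \<in> U" if "\<rho> \<in> S" for \<rho> using f that by (auto simp: U_def)
        have hU: "h \<rho> \<notin> U" if "\<rho> \<in> P - S" for \<rho> using h(2) that by blast
        show "\<rho> = \<sigma>"
          using * inj_onD[OF f(1), of \<rho> \<sigma>] inj_onD[OF h(1), of \<rho> \<sigma>] fU[of \<rho>] fU[of \<sigma>] hU[of \<rho>] hU[of \<sigma>]
          by (cases "\<rho> \<in> S"; cases "\<sigma> \<in> S") (auto simp: k_def)
      qed
      moreover have "\<forall>\<rho>\<in>P. k \<rho> \<in> F \<rho>" using f h by (auto simp: k_def)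
      ultimately show ?thesis by blast
    next
      case noS: False
      obtain \<rho> where \<rho>: "\<rho> \<in> P" using False by auto
      have "card {\<rho>} \<le> card (\<Union>\<rho>\<in>{\<rho>}. F \<rho>)" using \<rho> by (intro cond) auto
      then obtain x where x: "x \<in> F \<rho>" by fastforce
      have "\<exists>f. inj_on f (P - {\<rho>}) \<and> (\<forall>\<sigma>\<in>P - {\<rho>}. f \<sigma> \<in> F \<sigma> - {x})"
      proof (rule less.hyps)
        show "card (P - {\<rho>}) < card P" using \<rho> finP by (rule card_Diff1_less[rotated])
        fix T assume T: "T \<subseteq> P - {\<rho>}"
        show "card T \<le> card (\<Union>\<sigma>\<in>T. F \<sigma> - {x})"
        proof (cases "T = {}")
          case False
          have "T \<subset> P" using T \<rho> by auto
          then have "card T < card (\<Union>\<sigma>\<in>T. F \<sigma>)"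
            using noS False cond[of T] by (auto simp: le_less)
          also have "\<dots> \<le> card ((\<Union>\<sigma>\<in>T. F \<sigma>) - {x}) + 1"
            using finU[of T] \<open>T \<subset> P\<close> by (auto simp: card_Diff_singleton_if)
          also have "(\<Union>\<sigma>\<in>T. F \<sigma>) - {x} = (\<Union>\<sigma>\<in>T. F \<sigma> - {x})" by auto
          finally show ?thesis by simp
        qed simp
      qed (use finP finF in auto)
      then obtain f where f: "inj_on f (P - {\<rho>})" "\<forall>\<sigma>\<in>P - {\<rho>}. f \<sigma> \<in> F \<sigma> - {x}" by blast
      then show ?thesis
        using x \<rho> by (intro exI[of _ "f(\<rho> := x)"]) (auto simp: inj_on_def)
    qed
  qed auto
qed

section \<open>Generic square systems\<close>

text \<open>For index sets of equal finite size this says that the square matrix \<open>a\<close> is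
  invertible, without ordering its rows and columns.\<close>

definition solvable :: "'r set \<Rightarrow> 'q set \<Rightarrow> ('r \<Rightarrow> 'q \<Rightarrow> 'k::field) \<Rightarrow> bool" where
  "solvable R Q a \<longleftrightarrow> (\<forall>z. \<exists>u. \<forall>\<rho>\<in>R. (\<Sum>q\<in>Q. a \<rho> q * u q) = z \<rho>)"

lemma solvable_iff_det:
  fixes a :: "'r \<Rightarrow> 'q \<Rightarrow> 'k::field"
  assumes f: "bij_betw f {..<N} R" and g: "bij_betw g {..<N} Q"
  defines "M \<equiv> mat N N (\<lambda>(i, j). a (f i) (g j))"
  shows "solvable R Q a \<longleftrightarrow> det M \<noteq> 0"
    and "det M \<noteq> 0 \<Longrightarrow> (\<And>\<rho>. \<rho> \<in> R \<Longrightarrow> (\<Sum>q\<in>Q. a \<rho> q * w q) = 0) \<Longrightarrow> q \<in> Q \<Longrightarrow> w q = 0"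
proof -
  have M: "M \<in> carrier_mat N N" by (simp add: M_def)
  have sumQ: "(\<Sum>q\<in>Q. h q) = (\<Sum>j<N. h (g j))" for h :: "'q \<Rightarrow> 'k"
    by (rule sum.reindex_bij_betw[OF g, symmetric])
  have fR: "f i \<in> R" if "i < N" for i using bij_betwE[OF f] that by auto
  have Mv: "(M *\<^sub>v vec N (\<lambda>j. w (g j))) $ i = (\<Sum>q\<in>Q. a (f i) q * w q)" if "i < N" for i and w :: "'q \<Rightarrow> 'k"
    using that by (simp add: sumQ M_def scalar_prod_def atLeast0LessThan)
  have inv: "\<exists>B\<in>carrier_mat N N. B * M = 1\<^sub>m N \<and> M * B = 1\<^sub>m N" if "det M \<noteq> 0"
    using det_non_zero_imp_unit[OF M that, of "()"] by (auto simp: Units_def ring_mat_def)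
  show "solvable R Q a \<longleftrightarrow> det M \<noteq> 0"
  proof
    assume sol: "solvable R Q a"
    \<comment> \<open>Solutions for the unit vectors are the columns of a right inverse.\<close>
    have "\<exists>u. \<forall>\<rho>\<in>R. (\<Sum>q\<in>Q. a \<rho> q * u q) = (if \<rho> = f b then 1 else 0)" for b
      using sol unfolding solvable_def by (rule spec)
    then obtain u where u: "\<And>b \<rho>. \<rho> \<in> R \<Longrightarrow> (\<Sum>q\<in>Q. a \<rho> q * u b q) = (if \<rho> = f b then 1 else 0)"
      by metis
    define U where "U = mat N N (\<lambda>(j, b). u b (g j))"
    have U: "U \<in> carrier_mat N N" by (simp add: U_def)
    have "M * U = 1\<^sub>m N"
    proof (rule eq_matI)
      fix i b assume "i < dim_row (1\<^sub>m N)" "b < dim_col (1\<^sub>m N)"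
      then have ib: "i < N" "b < N" by auto
      have "(M * U) $$ (i, b) = (\<Sum>q\<in>Q. a (f i) q * u b q)"
        using ib by (simp add: M_def U_def scalar_prod_def sumQ atLeast0LessThan)
      also have "\<dots> = (if i = b then 1 else 0)"
        using ib f fR by (auto simp: u bij_betw_def inj_on_def)
      finally show "(M * U) $$ (i, b) = 1\<^sub>m N $$ (i, b)" using ib by simp
    qed (simp_all add: M_def U_def)
    then have "det M * det U = 1" using det_mult[OF M U] by simp
    then show "det M \<noteq> 0" by auto
  next
    assume "det M \<noteq> 0"
    then obtain B where B: "B \<in> carrier_mat N N" "M * B = 1\<^sub>m N" using inv by auto
    show "solvable R Q a"
      unfolding solvable_def
    proof
      fix z
      define v where "v = B *\<^sub>v vec N (\<lambda>i. z (f i))"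
      have v: "v \<in> carrier_vec N" using B by (simp add: v_def)
      define u where "u q = v $ (the_inv_into {..<N} g q)" for q
      have "vec N (\<lambda>j. u (g j)) = v"
        using v g by (intro eq_vecI) (auto simp: u_def bij_betw_def the_inv_into_f_f)
      then have "M *\<^sub>v vec N (\<lambda>j. u (g j)) = M *\<^sub>v v" by simp
      also have "\<dots> = (M * B) *\<^sub>v vec N (\<lambda>i. z (f i))"
        unfolding v_def by (rule assoc_mult_mat_vec[OF M B(1), symmetric]) simp
      finally have "M *\<^sub>v vec N (\<lambda>j. u (g j)) = (M * B) *\<^sub>v vec N (\<lambda>i. z (f i))" .
      then have eq: "M *\<^sub>v vec N (\<lambda>j. u (g j)) = vec N (\<lambda>i. z (f i))" by (simp add: B(2))
      have "(\<Sum>q\<in>Q. a \<rho> q * u q) = z \<rho>" if "\<rho> \<in> R" for \<rho>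
      proof -
        obtain i where i: "i < N" "\<rho> = f i" using \<open>\<rho> \<in> R\<close> f by (auto simp: bij_betw_def)
        then show ?thesis using Mv[OF i(1), of u] by (simp add: eq)
      qed
      then show "\<exists>u. \<forall>\<rho>\<in>R. (\<Sum>q\<in>Q. a \<rho> q * u q) = z \<rho>" by blast
    qed
  qed
  assume "det M \<noteq> 0" and w: "\<And>\<rho>. \<rho> \<in> R \<Longrightarrow> (\<Sum>q\<in>Q. a \<rho> q * w q) = 0" and q: "q \<in> Q"
  then obtain B where B: "B \<in> carrier_mat N N" "B * M = 1\<^sub>m N" using inv by auto
  have "M *\<^sub>v vec N (\<lambda>j. w (g j)) = 0\<^sub>v N"
    using M by (intro eq_vecI) (auto simp: Mv w fR simp del: index_mult_mat_vec)
  then have "B *\<^sub>v (M *\<^sub>v vec N (\<lambda>j. w (g j))) = 0\<^sub>v N"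
    using B(1) by (intro eq_vecI) auto
  then have "(B * M) *\<^sub>v vec N (\<lambda>j. w (g j)) = 0\<^sub>v N"
    by (subst assoc_mult_mat_vec[OF B(1) M]) auto
  then have "vec N (\<lambda>j. w (g j)) = 0\<^sub>v N" by (simp add: B(2))
  moreover obtain j where "j < N" "q = g j" using q g by (auto simp: bij_betw_def)
  ultimately show "w q = 0" by (metis index_vec index_zero_vec(1))
qed

lemma solvable_unique:
  fixes a :: "'r \<Rightarrow> 'q \<Rightarrow> 'k::field"
  assumes "finite R" "finite Q" "card R = card Q" "solvable R Q a"
    and "\<And>\<rho>. \<rho> \<in> R \<Longrightarrow> (\<Sum>q\<in>Q. a \<rho> q * w q) = 0" "q \<in> Q"
  shows "w q = 0"
proof -
  obtain f g where "bij_betw f {..<card R} R" "bij_betw g {..<card R} Q"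
    using ex_bij_betw_nat_finite[OF assms(1)] ex_bij_betw_nat_finite[OF assms(2)] assms(3)
    by (metis atLeast0LessThan)
  then show ?thesis using solvable_iff_det[of f "card R" R g Q a] assms by blast
qed

text \<open>These are the principal open sets: every condition below is the nonvanishing of one
  determinant or one variable, and intersections are handled through products.\<close>

definition Zariski_open :: "(('v \<Rightarrow> 'k::field) \<Rightarrow> bool) \<Rightarrow> bool" where
  "Zariski_open C \<longleftrightarrow> (\<exists>p. \<forall>x. C x \<longleftrightarrow> eval_at x p \<noteq> 0)"

lemma Zariski_open_solvable:
  fixes F :: "'r \<Rightarrow> 'q \<Rightarrow> ('v, 'k::field) mpoly"
  assumes "finite R" "finite Q" "card R = card Q"
  shows "Zariski_open (\<lambda>x. solvable R Q (\<lambda>\<rho> q. eval_at x (F \<rho> q)))"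
proof -
  obtain f g where fg: "bij_betw f {..<card R} R" "bij_betw g {..<card R} Q"
    using ex_bij_betw_nat_finite[OF assms(1)] ex_bij_betw_nat_finite[OF assms(2)] assms(3)
    by (metis atLeast0LessThan)
  define p where "p = det (mat (card R) (card R) (\<lambda>(i, j). F (f i) (g j)))"
  have "solvable R Q (\<lambda>\<rho> q. eval_at x (F \<rho> q)) \<longleftrightarrow> eval_at x p \<noteq> 0" for x
  proof -
    interpret ev: comm_ring_hom "eval_at x" by (rule comm_ring_hom_eval_poly[OF comm_ring_hom_id])
    have "eval_at x p = det (mat (card R) (card R) (\<lambda>(i, j). eval_at x (F (f i) (g j))))"
      unfolding p_def ev.hom_det[symmetric] by (intro arg_cong[of _ _ det] eq_matI) auto
    then show ?thesis by (simp add: solvable_iff_det(1)[OF fg])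
  qed
  then show ?thesis unfolding Zariski_open_def by blast
qed

text \<open>A condition that holds somewhere has a nonzero polynomial. The product of these
  polynomials is nonzero too, hence nonzero at some point over the infinite field.\<close>

lemma Zariski_open_common_point:
  fixes \<C> :: "(('v::linorder \<Rightarrow> 'k::field) \<Rightarrow> bool) set"
  assumes inf: "infinite (UNIV :: 'k set)" and "finite \<C>"
    and op: "\<And>C. C \<in> \<C> \<Longrightarrow> Zariski_open C" and ne: "\<And>C. C \<in> \<C> \<Longrightarrow> \<exists>x. C x"
  shows "\<exists>x. \<forall>C\<in>\<C>. C x"
proof -
  obtain p where p: "\<And>C x. C \<in> \<C> \<Longrightarrow> C x \<longleftrightarrow> eval_at x (p C) \<noteq> 0"
    using op unfolding Zariski_open_def by metis
  have "p C \<noteq> 0" if "C \<in> \<C>" for C using ne[OF that] p[OF that] by auto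
  then have "(\<Prod>C\<in>\<C>. p C) \<noteq> 0" using assms(2) by (intro mpoly_prod_nonzero)
  then obtain x where x: "eval_at x (\<Prod>C\<in>\<C>. p C) \<noteq> 0" using exists_nonzero_eval[OF inf] by blast
  interpret ev: comm_ring_hom "eval_at x" by (rule comm_ring_hom_eval_poly[OF comm_ring_hom_id])
  have "eval_at x (p C) \<noteq> 0" if "C \<in> \<C>" for C
    using x that assms(2) by (auto simp: ev.hom_prod)
  then show ?thesis using p by blast
qed

section \<open>Generic subspaces and linkage matching fields\<close>

text \<open>The entries in row \<open>\<rho>\<close> are independent variables on
  \<open>F \<rho>\<close> and zero elsewhere. Deleting the \<open>r\<close> columns
  \<open>\<tau>\<close> lowers each union in \<open>hall\<close> by at most \<open>r\<close>, so
  Hall's theorem matches the rows to remaining columns, and the minor off \<open>\<tau>\<close> is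
  nonzero at the matching. A common point of these open conditions and of those at the
  \<open>i \<rho>\<close> gives \<open>y\<close>.\<close>

lemma exists_generic_support_matrix:
  fixes P :: "'r::linorder set" and F :: "'r \<Rightarrow> nat set"
  assumes inf: "infinite (UNIV :: 'k::field set)"
    and P: "finite P" "card P + r = m" and F: "\<And>\<rho>. \<rho> \<in> P \<Longrightarrow> F \<rho> \<subseteq> {..<m}"
    and i: "\<And>\<rho>. \<rho> \<in> P \<Longrightarrow> i \<rho> \<in> F \<rho>"
    and hall: "\<And>S. S \<subseteq> P \<Longrightarrow> S \<noteq> {} \<Longrightarrow> card S + r \<le> card (\<Union>\<rho>\<in>S. F \<rho>)"
  obtains y :: "'r \<Rightarrow> nat \<Rightarrow> 'k::field" where
    "\<And>\<rho> q. q \<notin> F \<rho> \<Longrightarrow> y \<rho> q = 0" "\<And>\<rho>. \<rho> \<in> P \<Longrightarrow> y \<rho> (i \<rho>) \<noteq> 0"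
    "\<And>\<tau>. \<tau> \<subseteq> {..<m} \<Longrightarrow> card \<tau> = r \<Longrightarrow> solvable P ({..<m} - \<tau>) y"
proof -
  define Y where "Y \<rho> q = (if q \<in> F \<rho> then Var (\<rho>, q) else 0 :: ('r \<times> nat, 'k) mpoly)" for \<rho> q
  have evY: "eval_at x (Y \<rho> q) = (if q \<in> F \<rho> then x (\<rho>, q) else 0)" for x \<rho> q
    by (simp add: Y_def eval_poly_Var[OF comm_ring_hom_id])
  define Cs where "Cs \<tau> x \<longleftrightarrow> solvable P ({..<m} - \<tau>) (\<lambda>\<rho> q. eval_at x (Y \<rho> q))" for \<tau> x
  define Ci where "Ci \<rho> x \<longleftrightarrow> x (\<rho>, i \<rho>) \<noteq> (0 :: 'k)" for \<rho> and x :: "'r \<times> nat \<Rightarrow> 'k"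
  let ?T = "{\<tau>. \<tau> \<subseteq> {..<m} \<and> card \<tau> = r}"
  have cardQ: "card P = card ({..<m} - \<tau>)" if "\<tau> \<in> ?T" for \<tau>
    using that P by (auto simp: card_Diff_subset finite_subset)
  have "\<exists>x. \<forall>C\<in>Cs ` ?T \<union> Ci ` P. C x"
  proof (rule Zariski_open_common_point[OF inf])
    show "finite (Cs ` ?T \<union> Ci ` P)" using P by simp
    fix C assume "C \<in> Cs ` ?T \<union> Ci ` P"
    then consider \<tau> where "\<tau> \<in> ?T" "C = Cs \<tau>" | \<rho> where "\<rho> \<in> P" "C = Ci \<rho>" by blast
    then have "Zariski_open C \<and> (\<exists>x. C x)"
    proof cases
      case 1
      have "Zariski_open (Cs \<tau>)"
        unfolding Cs_def using P cardQ[OF 1(1)] by (intro Zariski_open_solvable) auto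
      moreover have "\<exists>x. Cs \<tau> x"
      proof -
        have fin: "finite (F \<rho>)" if "\<rho> \<in> P" for \<rho> using F[OF that] by (rule finite_subset) simp
        have "\<exists>f. inj_on f P \<and> (\<forall>\<rho>\<in>P. f \<rho> \<in> F \<rho> - \<tau>)"
        proof (rule hall_marriage[OF P(1)])
          fix S assume S: "S \<subseteq> P"
          show "card S \<le> card (\<Union>\<rho>\<in>S. F \<rho> - \<tau>)"
          proof (cases "S = {}")
            case False
            have "(\<Union>\<rho>\<in>S. F \<rho> - \<tau>) = (\<Union>\<rho>\<in>S. F \<rho>) - \<tau>" by auto
            moreover have "card (\<Union>\<rho>\<in>S. F \<rho>) - card \<tau> \<le> card ((\<Union>\<rho>\<in>S. F \<rho>) - \<tau>)"
              using 1 by (intro diff_card_le_card_Diff) (auto intro: finite_subset)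
            ultimately show ?thesis using hall[OF S False] 1 by simp
          qed simp
        qed (use fin in auto)
        then obtain f where f: "inj_on f P" "\<And>\<rho>. \<rho> \<in> P \<Longrightarrow> f \<rho> \<in> F \<rho> - \<tau>" by blast
        \<comment> \<open>The specialisation is the 0-1 matrix of the matching; a system is solved
          by moving each \<open>z \<rho>\<close> to column \<open>f \<rho>\<close>.\<close>
        define x where "x = (\<lambda>(\<rho>, q). if q = f \<rho> then 1 else 0 :: 'k)"
        have "(\<Sum>q\<in>{..<m} - \<tau>. eval_at x (Y \<rho> q) * z (inv_into P f q)) = z \<rho>" if "\<rho> \<in> P" for z \<rho>
        proof -
          have "(\<Sum>q\<in>{..<m} - \<tau>. eval_at x (Y \<rho> q) * z (inv_into P f q)) =
              (\<Sum>q\<in>{..<m} - \<tau>. if q = f \<rho> then z \<rho> else 0)"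
            using f that by (intro sum.cong refl) (auto simp: evY x_def)
          also have "\<dots> = z \<rho>" using f(2)[OF that] F[OF that] by (subst sum.delta) auto
          finally show ?thesis .
        qed
        then have "Cs \<tau> x" unfolding Cs_def solvable_def by (intro allI exI ballI)
        then show ?thesis by blast
      qed
      ultimately show ?thesis using 1 by simp
    next
      case 2
      have "Zariski_open (Ci \<rho>)"
        unfolding Zariski_open_def Ci_def
        by (intro exI[of _ "Var (\<rho>, i \<rho>)"]) (simp add: eval_poly_Var[OF comm_ring_hom_id])
      moreover have "Ci \<rho> (\<lambda>_. 1)" by (simp add: Ci_def)
      ultimately show ?thesis using 2 by blast
    qed
    then show "Zariski_open C" "\<exists>x. C x" by auto
  qed
  then obtain x where "\<forall>C\<in>Cs ` ?T \<union> Ci ` P. C x" ..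
  then have x: "\<And>\<tau>. \<tau> \<in> ?T \<Longrightarrow> Cs \<tau> x" "\<And>\<rho>. \<rho> \<in> P \<Longrightarrow> Ci \<rho> x" by auto
  show thesis
  proof (rule that[of "\<lambda>\<rho> q. eval_at x (Y \<rho> q)"])
    show "eval_at x (Y \<rho> q) = 0" if "q \<notin> F \<rho>" for \<rho> q using that by (simp add: evY)
    show "eval_at x (Y \<rho> (i \<rho>)) \<noteq> 0" if "\<rho> \<in> P" for \<rho>
      using x(2)[OF that] i[OF that] by (simp add: evY Ci_def)
    show "solvable P ({..<m} - \<tau>) (\<lambda>\<rho> q. eval_at x (Y \<rho> q))" if "\<tau> \<subseteq> {..<m}" "card \<tau> = r" for \<tau>
      using x(1)[of \<tau>] that by (simp add: Cs_def)
  qed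
qed

text \<open>The last \<open>m - r\<close> columns of \<open>y\<close> form an invertible matrix, so
  kernel vectors are determined by their first \<open>r\<close> coordinates, and the columns of
  \<open>A\<close> extend the unit vectors. Invertibility off \<open>\<tau>\<close> allows the
  coordinates in \<open>\<tau>\<close> to be prescribed instead.\<close>

lemma exists_kernel_basis:
  fixes y :: "'r \<Rightarrow> nat \<Rightarrow> 'k::field"
  assumes P: "finite P" "card P + r = m"
    and sol: "\<And>\<tau>. \<tau> \<subseteq> {..<m} \<Longrightarrow> card \<tau> = r \<Longrightarrow> solvable P ({..<m} - \<tau>) y"
  obtains A :: "nat \<times> nat \<Rightarrow> 'k::field" where
    "\<And>\<rho> b. \<rho> \<in> P \<Longrightarrow> (\<Sum>q<m. y \<rho> q * (\<Sum>s<r. A (q, s) * b s)) = 0"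
    "\<And>\<tau> z. \<tau> \<subseteq> {..<m} \<Longrightarrow> card \<tau> = r \<Longrightarrow> \<exists>b. \<forall>i\<in>\<tau>. (\<Sum>s<r. A (i, s) * b s) = z i"
proof -
  let ?Q = "{..<m} - {..<r}"
  have rm: "r \<le> m" using P by simp
  have split: "(\<Sum>q<m. h q) = (\<Sum>q\<in>\<tau>. h q) + (\<Sum>q\<in>{..<m} - \<tau>. h q)" if "\<tau> \<subseteq> {..<m}" for h :: "nat \<Rightarrow> 'k" and \<tau>
    using that by (subst sum.subset_diff[of \<tau>]) auto
  have sol0: "solvable P ?Q y" using rm by (intro sol) auto
  have "\<exists>u. \<forall>\<rho>\<in>P. (\<Sum>q\<in>?Q. y \<rho> q * u q) = - y \<rho> s" for s
    using sol0 unfolding solvable_def by (rule spec)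
  then obtain u where u: "\<And>s \<rho>. \<rho> \<in> P \<Longrightarrow> (\<Sum>q\<in>?Q. y \<rho> q * u s q) = - y \<rho> s" by metis
  define A where "A = (\<lambda>(q, s). if q < r then (if q = s then 1 else 0) else u s q)"
  have top: "(\<Sum>s<r. A (q, s) * b s) = b q" if "q < r" for q b
  proof -
    have "(\<Sum>s<r. A (q, s) * b s) = (\<Sum>s<r. if s = q then b s else 0)"
      using that by (intro sum.cong) (auto simp: A_def)
    then show ?thesis using that by simp
  qed
  have ker: "(\<Sum>q<m. y \<rho> q * (\<Sum>s<r. A (q, s) * b s)) = 0" if "\<rho> \<in> P" for \<rho> b
  proof -
    have "(\<Sum>q<m. y \<rho> q * (\<Sum>s<r. A (q, s) * b s)) =
        (\<Sum>q<r. y \<rho> q * b q) + (\<Sum>q\<in>?Q. y \<rho> q * (\<Sum>s<r. A (q, s) * b s))"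
      using rm by (subst split[of "{..<r}"]) (auto simp: top)
    also have "(\<Sum>q\<in>?Q. y \<rho> q * (\<Sum>s<r. A (q, s) * b s)) = (\<Sum>q\<in>?Q. \<Sum>s<r. b s * (y \<rho> q * u s q))"
      by (intro sum.cong refl) (auto simp: A_def sum_distrib_left algebra_simps)
    also have "\<dots> = (\<Sum>s<r. b s * (\<Sum>q\<in>?Q. y \<rho> q * u s q))"
      by (subst sum.swap) (simp add: sum_distrib_left)
    also have "\<dots> = - (\<Sum>s<r. y \<rho> s * b s)"
      by (simp only: u[OF that]) (simp add: sum_negf mult.commute)
    finally show ?thesis by simp
  qed
  show thesis
  proof (rule that[OF ker])
    fix \<tau> and z :: "nat \<Rightarrow> 'k" assume \<tau>: "\<tau> \<subseteq> {..<m}" "card \<tau> = r"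
    have "\<exists>v. \<forall>\<rho>\<in>P. (\<Sum>q\<in>{..<m} - \<tau>. y \<rho> q * v q) = - (\<Sum>q\<in>\<tau>. y \<rho> q * z q)"
      using sol[OF \<tau>] unfolding solvable_def by (rule spec)
    then obtain v where v: "\<And>\<rho>. \<rho> \<in> P \<Longrightarrow> (\<Sum>q\<in>{..<m} - \<tau>. y \<rho> q * v q) = - (\<Sum>q\<in>\<tau>. y \<rho> q * z q)"
      by blast
    define v' where "v' q = (if q \<in> \<tau> then z q else v q)" for q
    have yv: "(\<Sum>q<m. y \<rho> q * v' q) = 0" if "\<rho> \<in> P" for \<rho>
    proof -
      have "(\<Sum>q<m. y \<rho> q * v' q) = (\<Sum>q\<in>\<tau>. y \<rho> q * z q) + (\<Sum>q\<in>{..<m} - \<tau>. y \<rho> q * v q)"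
        unfolding split[OF \<tau>(1)] by (intro arg_cong2[of _ _ _ _ "(+)"] sum.cong) (auto simp: v'_def)
      then show ?thesis by (simp add: v[OF that])
    qed
    \<comment> \<open>\<open>v'\<close> lies in the kernel, and so does the combination of columns
      of \<open>A\<close> with the same first \<open>r\<close> coordinates; their difference
      \<open>w\<close> vanishes by uniqueness.\<close>
    define w where "w q = v' q - (\<Sum>s<r. A (q, s) * v' s)" for q
    have w_top: "w q = 0" if "q < r" for q using top[OF that] by (simp add: w_def)
    have w0: "w q = 0" if "q \<in> ?Q" for q
    proof (rule solvable_unique[OF P(1) _ _ sol0 _ that])
      show "card P = card ?Q" using P rm by (simp add: card_Diff_subset)
      fix \<rho> assume \<rho>: "\<rho> \<in> P"
      have "0 = (\<Sum>q<m. y \<rho> q * w q)"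
        using yv[OF \<rho>] ker[OF \<rho>, of v'] by (simp add: w_def right_diff_distrib sum_subtractf)
      also have "\<dots> = (\<Sum>q\<in>?Q. y \<rho> q * w q)"
        using rm by (subst split[of "{..<r}"]) (auto simp: w_top)
      finally show "(\<Sum>q\<in>?Q. y \<rho> q * w q) = 0" by simp
    qed simp
    have "(\<Sum>s<r. A (i, s) * v' s) = z i" if "i \<in> \<tau>" for i
    proof -
      have "w i = 0" using w0[of i] w_top[of i] that \<tau> by fastforce
      then show ?thesis using that by (simp add: w_def v'_def)
    qed
    then show "\<exists>b. \<forall>i\<in>\<tau>. (\<Sum>s<r. A (i, s) * b s) = z i" by blast
  qed
qed

text \<open>Surjectivity, onto the entries in \<open>Omega \<omega> J\<close>, of the derivative of
  the matrix product \<open>A B\<close> at a point where all columns \<open>j \<in> J\<close> of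
  \<open>B\<close> are the same unit vector: \<open>b j\<close> is the change of column
  \<open>j\<close> of \<open>B\<close>, and \<open>\<delta>\<close> that of the one column of
  \<open>A\<close> which the unit vector selects.\<close>

definition tangent_onto :: "nat \<Rightarrow> (nat \<Rightarrow> nat set) \<Rightarrow> nat set \<Rightarrow> (nat \<times> nat \<Rightarrow> 'k::field) \<Rightarrow> bool" where
  "tangent_onto r \<omega> J A \<longleftrightarrow>
     (\<forall>x. \<exists>\<delta> b. \<forall>j\<in>J. \<forall>i\<in>\<omega> j. (\<Sum>s<r. A (i, s) * b j s) + \<delta> i = x (i, j))"

text \<open>Each \<open>i\<close> in \<open>\<omega> j\<close> outside a chosen
  \<open>r\<close>-subset \<open>\<tau> j\<close> gives a row supported in
  \<open>insert i (\<tau> j)\<close>. The SLMF conditions yield \<open>m - r\<close> rows with the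
  strengthened Hall condition, so suitable rows form a basis of the left kernel of a matrix
  \<open>A\<close> of rank \<open>r\<close>. Then \<open>\<delta>\<close> is chosen to meet all
  kernel conditions at once, and the \<open>b j\<close> follow.\<close>

lemma exists_tangent_onto:
  assumes inf: "infinite (UNIV :: 'k::field set)"
    and J: "finite J" and rm: "r < m"
    and \<omega>: "\<And>j. j \<in> J \<Longrightarrow> \<omega> j \<subseteq> {..<m}" "\<And>j. j \<in> J \<Longrightarrow> r \<le> card (\<omega> j)"
    and slmf: "relaxed_SLMF 1 r m \<omega> J"
  shows "\<exists>A :: nat \<times> nat \<Rightarrow> 'k. tangent_onto r \<omega> J A"
proof -
  have fin\<omega>: "finite (\<omega> j)" if "j \<in> J" for j using \<omega>(1)[OF that] by (rule finite_subset) simp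
  have "\<exists>\<tau>. \<tau> \<subseteq> \<omega> j \<and> card \<tau> = r" if "j \<in> J" for j
    using obtain_subset_with_card_n[OF \<omega>(2)[OF that]] by metis
  then obtain \<tau> where \<tau>: "\<And>j. j \<in> J \<Longrightarrow> \<tau> j \<subseteq> \<omega> j" "\<And>j. j \<in> J \<Longrightarrow> card (\<tau> j) = r" by metis
  define P where "P = (SIGMA j:J. \<omega> j - \<tau> j)"
  define F where "F = (\<lambda>(j, i). insert i (\<tau> j))"
  have fin\<tau>: "finite (\<tau> j)" if "j \<in> J" for j using \<tau>(1)[OF that] fin\<omega>[OF that] by (rule finite_subset)
  have finP: "finite P" using J fin\<omega> by (auto simp: P_def)
  have "int (card P) = (\<Sum>j\<in>J. int (card (\<omega> j - \<tau> j)))"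
    using J fin\<omega> by (simp add: P_def)
  \<comment> \<open>Since \<open>r \<le> card (\<omega> j)\<close>, the truncation at zero has no
    effect, and the SLMF equality counts \<open>P\<close>.\<close>
  also have "\<dots> = (\<Sum>j\<in>J. max (int (card (\<omega> j \<inter> {..<m})) - int r) 0)"
  proof (rule sum.cong)
    fix j assume j: "j \<in> J"
    have "\<omega> j \<inter> {..<m} = \<omega> j" using \<omega>(1)[OF j] by auto
    then show "int (card (\<omega> j - \<tau> j)) = max (int (card (\<omega> j \<inter> {..<m})) - int r) 0"
      using \<tau>[OF j] fin\<tau>[OF j] \<omega>(2)[OF j] by (simp add: card_Diff_subset of_nat_diff)
  qed simp
  also have "\<dots> = int m - int r" using slmf by (simp add: relaxed_SLMF_def)
  finally have cardP: "card P + r = m" by simp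
  have F_sub: "F \<rho> \<subseteq> {..<m}" if "\<rho> \<in> P" for \<rho>
  proof -
    obtain j i where "\<rho> = (j, i)" "j \<in> J" "i \<in> \<omega> j" using \<open>\<rho> \<in> P\<close> by (auto simp: P_def)
    then show ?thesis using \<omega>(1)[of j] \<tau>(1)[of j] by (auto simp: F_def)
  qed
  have hallP: "card S + r \<le> card (\<Union>\<rho>\<in>S. F \<rho>)" if S: "S \<subseteq> P" "S \<noteq> {}" for S
  proof -
    define I where "I = (\<Union>\<rho>\<in>S. F \<rho>)"
    define D where "D j = {i. (j, i) \<in> S}" for j
    have D: "D j \<subseteq> \<omega> j - \<tau> j" if "j \<in> J" for j using S by (auto simp: D_def P_def)
    have finD: "finite (D j)" if "j \<in> J" for j using D[OF that] fin\<omega>[OF that] by (auto intro: finite_subset)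
    have S_eq: "S = (SIGMA j:J. D j)" using S by (auto simp: D_def P_def)
    have I_sub: "I \<subseteq> {..<m}" using S F_sub by (auto simp: I_def)
    have finI: "finite I" using I_sub by (rule finite_subset) simp
    \<comment> \<open>A nonempty \<open>D j\<close> brings all of \<open>\<tau> j\<close> into
      \<open>I\<close>, so \<open>card (D j)\<close> is at most the excess of
      \<open>card (\<omega> j \<inter> I)\<close> over \<open>r\<close>.\<close>
    have sub: "\<tau> j \<union> D j \<subseteq> \<omega> j \<inter> I" if "j \<in> J" "D j \<noteq> {}" for j
    proof -
      obtain i where "(j, i) \<in> S" using \<open>D j \<noteq> {}\<close> by (auto simp: D_def)
      then have "\<tau> j \<subseteq> I" by (force simp: I_def F_def)
      moreover have "D j \<subseteq> I" by (force simp: I_def F_def D_def)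
      ultimately show ?thesis using \<tau>(1)[OF that(1)] D[OF that(1)] by auto
    qed
    have card_sub: "card (D j) + r \<le> card (\<omega> j \<inter> I)" if "j \<in> J" "D j \<noteq> {}" for j
    proof -
      have "card (D j) + r = card (\<tau> j \<union> D j)"
        using that D[OF that(1)] \<tau>(2)[OF that(1)] fin\<tau> finD by (subst card_Un_disjoint) auto
      also have "\<dots> \<le> card (\<omega> j \<inter> I)" using sub[OF that] finI by (intro card_mono) auto
      finally show ?thesis .
    qed
    have "int (card S) = (\<Sum>j\<in>J. int (card (D j)))"
      using J finD by (simp add: S_eq)
    also have "\<dots> \<le> (\<Sum>j\<in>J. max (int (card (\<omega> j \<inter> I)) - int r) 0)"
    proof (rule sum_mono)
      fix j assume "j \<in> J"
      then show "int (card (D j)) \<le> max (int (card (\<omega> j \<inter> I)) - int r) 0"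
        using card_sub[of j] by (cases "D j = {}") auto
    qed
    also have "\<dots> \<le> int (card I) - int r"
    proof -
      obtain j i where ji: "(j, i) \<in> S" using S by auto
      then have j: "j \<in> J" "i \<in> D j" using S by (auto simp: P_def D_def)
      then have "D j \<noteq> {}" "0 < card (D j)" using finD by (auto simp: card_gt_0_iff)
      \<comment> \<open>Nonemptiness of \<open>S\<close> makes \<open>I\<close> large enough for the
        SLMF inequality to apply.\<close>
      then have "r + 1 \<le> card (\<omega> j \<inter> I)" using card_sub[of j] j by auto
      also have "\<dots> \<le> card I" using finI by (intro card_mono) auto
      finally show ?thesis using slmf I_sub by (auto simp: relaxed_SLMF_def)
    qed
    finally show ?thesis by (simp add: I_def)
  qed
  obtain y :: "nat \<times> nat \<Rightarrow> nat \<Rightarrow> 'k" where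
    y: "\<And>\<rho> q. q \<notin> F \<rho> \<Longrightarrow> y \<rho> q = 0" "\<And>\<rho>. \<rho> \<in> P \<Longrightarrow> y \<rho> (snd \<rho>) \<noteq> 0"
      "\<And>T. T \<subseteq> {..<m} \<Longrightarrow> card T = r \<Longrightarrow> solvable P ({..<m} - T) y"
  proof (rule exists_generic_support_matrix[OF inf finP cardP _ _ hallP, where i = snd])
    show "F \<rho> \<subseteq> {..<m}" if "\<rho> \<in> P" for \<rho> using that by (rule F_sub)
  qed (auto simp: F_def)
  obtain A :: "nat \<times> nat \<Rightarrow> 'k" where
    A: "\<And>\<rho> b. \<rho> \<in> P \<Longrightarrow> (\<Sum>q<m. y \<rho> q * (\<Sum>s<r. A (q, s) * b s)) = 0"
      "\<And>T z. T \<subseteq> {..<m} \<Longrightarrow> card T = r \<Longrightarrow> \<exists>b. \<forall>i\<in>T. (\<Sum>s<r. A (i, s) * b s) = z i"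
    using exists_kernel_basis[OF finP cardP y(3)] by blast
  have "\<exists>\<delta> b. \<forall>j\<in>J. \<forall>i\<in>\<omega> j. (\<Sum>s<r. A (i, s) * b j s) + \<delta> i = x (i, j)" for x
  proof -
    \<comment> \<open>Solve for one \<open>\<delta>\<close>, zero in its first \<open>r\<close>
      coordinates, such that column \<open>j\<close> of \<open>x\<close> minus
      \<open>\<delta>\<close> is orthogonal to every row \<open>y (j, i)\<close>.\<close>
    have "solvable P ({..<m} - {..<r}) y" using rm by (intro y(3)) auto
    then have "\<exists>u. \<forall>\<rho>\<in>P. (\<Sum>q\<in>{..<m} - {..<r}. y \<rho> q * u q) = (\<Sum>q<m. y \<rho> q * x (q, fst \<rho>))"
      unfolding solvable_def by (rule spec)
    then obtain u where u: "\<And>\<rho>. \<rho> \<in> P \<Longrightarrow> (\<Sum>q\<in>{..<m} - {..<r}. y \<rho> q * u q) = (\<Sum>q<m. y \<rho> q * x (q, fst \<rho>))"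
      by blast
    define \<delta> where "\<delta> q = (if q < r then 0 else u q)" for q
    have \<delta>: "(\<Sum>q<m. y \<rho> q * \<delta> q) = (\<Sum>q<m. y \<rho> q * x (q, fst \<rho>))" if "\<rho> \<in> P" for \<rho>
      unfolding u[OF that, symmetric]
      by (rule sum.mono_neutral_cong_right) (auto simp: \<delta>_def)
    have "\<exists>b. \<forall>i\<in>\<tau> j. (\<Sum>s<r. A (i, s) * b s) = x (i, j) - \<delta> i" if "j \<in> J" for j
      using A(2)[of "\<tau> j" "\<lambda>i. x (i, j) - \<delta> i"] \<tau>[OF that] \<omega>(1)[OF that] by blast
    then obtain b where b: "\<And>j i. j \<in> J \<Longrightarrow> i \<in> \<tau> j \<Longrightarrow> (\<Sum>s<r. A (i, s) * b j s) = x (i, j) - \<delta> i"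
      by metis
    have "(\<Sum>s<r. A (i, s) * b j s) + \<delta> i = x (i, j)" if ji: "j \<in> J" "i \<in> \<omega> j" for j i
    proof (cases "i \<in> \<tau> j")
      case True
      then show ?thesis using b[OF ji(1)] by simp
    next
      case False
      then have \<rho>: "(j, i) \<in> P" using ji by (simp add: P_def)
      \<comment> \<open>The residual \<open>w\<close> vanishes on \<open>\<tau> j\<close> and is
        orthogonal to \<open>y (j, i)\<close>, whose only other possible entry, at \<open>i\<close>,
        is nonzero.\<close>
      define w where "w q = (\<Sum>s<r. A (q, s) * b j s) - (x (q, j) - \<delta> q)" for q
      have "(\<Sum>q<m. y (j, i) q * w q) = 0"
        using A(1)[OF \<rho>, of "b j"] \<delta>[OF \<rho>] by (simp add: w_def right_diff_distrib sum_subtractf)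
      moreover have "(\<Sum>q<m. y (j, i) q * w q) = (\<Sum>q\<in>{i}. y (j, i) q * w q)"
      proof (rule sum.mono_neutral_right)
        show "{i} \<subseteq> {..<m}" using ji \<omega>(1) by auto
        show "\<forall>q\<in>{..<m} - {i}. y (j, i) q * w q = 0"
        proof
          fix q assume "q \<in> {..<m} - {i}"
          then show "y (j, i) q * w q = 0"
            using y(1)[of q "(j, i)"] b[OF ji(1), of q] by (auto simp: F_def w_def)
        qed
      qed simp
      ultimately have "w i = 0" using y(2)[OF \<rho>] by simp
      then show ?thesis by (simp add: w_def)
    qed
    then show ?thesis by blast
  qed
  then show ?thesis unfolding tangent_onto_def by blast
qed

text \<open>Fix the solutions \<open>b e\<close> and \<open>\<delta> e\<close> found at
  \<open>A0\<close> for the unit vectors and let \<open>A\<close> vary. The resulting square matrix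
  over \<open>E\<close> has polynomial entries in \<open>A\<close> and is the identity at
  \<open>A0\<close>; wherever it is invertible, combinations of the fixed solutions attain every
  \<open>x\<close>.\<close>

lemma tangent_onto_open:
  fixes A0 :: "nat \<times> nat \<Rightarrow> 'k::field"
  assumes J: "finite J" "\<And>j. j \<in> J \<Longrightarrow> finite (\<omega> j)" and A0: "tangent_onto r \<omega> J A0"
  shows "\<exists>C. Zariski_open C \<and> C A0 \<and> (\<forall>A. C A \<longrightarrow> tangent_onto r \<omega> J A)"
proof -
  define E where "E = Omega \<omega> J"
  have E: "(i, j) \<in> E \<longleftrightarrow> j \<in> J \<and> i \<in> \<omega> j" for i j by (auto simp: E_def Omega_def)
  have finE: "finite E" using J by (auto simp: E_def Omega_def)
  have "\<exists>\<delta> b. \<forall>j\<in>J. \<forall>i\<in>\<omega> j. (\<Sum>s<r. A0 (i, s) * b j s) + \<delta> i = (if (i, j) = e then 1 else 0)" for e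
    using A0 unfolding tangent_onto_def by (rule spec)
  then have "\<forall>e. \<exists>\<delta> b. \<forall>j\<in>J. \<forall>i\<in>\<omega> j. (\<Sum>s<r. A0 (i, s) * b j s) + \<delta> i = (if (i, j) = e then 1 else 0)" ..
  from choice[OF this] obtain \<delta> where
    "\<forall>e. \<exists>b. \<forall>j\<in>J. \<forall>i\<in>\<omega> j. (\<Sum>s<r. A0 (i, s) * b j s) + \<delta> e i = (if (i, j) = e then 1 else 0)"
    by blast
  from choice[OF this] obtain b where sol: "\<And>e i j. j \<in> J \<Longrightarrow> i \<in> \<omega> j \<Longrightarrow>
      (\<Sum>s<r. A0 (i, s) * b e j s) + \<delta> e i = (if (i, j) = e then 1 else 0)" by blast
  define F where "F = (\<lambda>(i, j) e. (\<Sum>s<r. Var (i, s) * Const (b e j s)) + Const (\<delta> e i) :: (nat \<times> nat, 'k) mpoly)"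
  have evF: "eval_at A (F (i, j) e) = (\<Sum>s<r. A (i, s) * b e j s) + \<delta> e i" for A i j e
    by (simp add: F_def eval_poly_add[OF comm_ring_hom_id] eval_poly_sum[OF comm_ring_hom_id]
      eval_poly_mult[OF comm_ring_hom_id] eval_poly_Var[OF comm_ring_hom_id]
      eval_poly_Const[OF comm_ring_hom_id])
  define C where "C A \<longleftrightarrow> solvable E E (\<lambda>a e. eval_at A (F a e))" for A
  have "Zariski_open C" unfolding C_def using finE by (intro Zariski_open_solvable) auto
  moreover have "C A0"
    unfolding C_def solvable_def
  proof
    fix z :: "nat \<times> nat \<Rightarrow> 'k"
    have "(\<Sum>e\<in>E. eval_at A0 (F a e) * z e) = z a" if "a \<in> E" for a
    proof -
      obtain i j where a: "a = (i, j)" by fastforce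
      have "(\<Sum>e\<in>E. eval_at A0 (F a e) * z e) = (\<Sum>e\<in>E. if e = a then z e else 0)"
        using that by (intro sum.cong refl) (auto simp: a E evF sol)
      then show ?thesis using that finE by simp
    qed
    then show "\<exists>u. \<forall>a\<in>E. (\<Sum>e\<in>E. eval_at A0 (F a e) * u e) = z a" by blast
  qed
  moreover have "tangent_onto r \<omega> J A" if "C A" for A
    unfolding tangent_onto_def
  proof
    fix x :: "nat \<times> nat \<Rightarrow> 'k"
    have "\<exists>u. \<forall>a\<in>E. (\<Sum>e\<in>E. eval_at A (F a e) * u e) = x a"
      using \<open>C A\<close> unfolding C_def solvable_def by (rule spec)
    then obtain u where u: "\<And>a. a \<in> E \<Longrightarrow> (\<Sum>e\<in>E. eval_at A (F a e) * u e) = x a" by blast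
    have "(\<Sum>s<r. A (i, s) * (\<Sum>e\<in>E. b e j s * u e)) + (\<Sum>e\<in>E. \<delta> e i * u e) = x (i, j)"
      if "j \<in> J" "i \<in> \<omega> j" for i j
    proof -
      have "x (i, j) = (\<Sum>e\<in>E. (\<Sum>s<r. A (i, s) * b e j s) * u e) + (\<Sum>e\<in>E. \<delta> e i * u e)"
        using u[of "(i, j)"] that by (simp add: E evF distrib_right sum.distrib)
      also have "(\<Sum>e\<in>E. (\<Sum>s<r. A (i, s) * b e j s) * u e) = (\<Sum>s<r. \<Sum>e\<in>E. A (i, s) * b e j s * u e)"
        by (simp add: sum_distrib_right sum.swap[of _ E])
      finally show ?thesis by (simp add: sum_distrib_left mult.assoc)
    qed
    then show "\<exists>\<delta> b. \<forall>j\<in>J. \<forall>i\<in>\<omega> j. (\<Sum>s<r. A (i, s) * b j s) + \<delta> i = x (i, j)"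
      by (intro exI[of _ "\<lambda>i. \<Sum>e\<in>E. \<delta> e i * u e"] exI[of _ "\<lambda>j s. \<Sum>e\<in>E. b e j s * u e"]) blast
  qed
  ultimately show ?thesis by blast
qed

section \<open>Relaxed linkage matching fields give bases\<close>

lemma eval_at_cong:
  assumes "\<And>v. v \<in> vars p \<Longrightarrow> x v = y v"
  shows "eval_at x p = eval_at y p"
proof -
  have "mon_eval x \<mu> = mon_eval y \<mu>" if "\<mu> \<in> Poly_Mapping.keys p" for \<mu>
    unfolding mon_eval_def
  proof (rule prod.cong)
    fix v assume "v \<in> Poly_Mapping.keys \<mu>"
    then have "v \<in> vars p" using that by (auto simp: vars_def)
    then show "x v ^ Poly_Mapping.lookup \<mu> v = y v ^ Poly_Mapping.lookup \<mu> v" by (simp add: assms)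
  qed simp
  then show ?thesis by (simp add: eval_poly_def)
qed

text \<open>Adding up the \<open>r\<close> SLMF equalities gives \<open>r * (m - r)\<close> as the
  sum of the excesses \<open>card (\<omega> j) - r\<close> truncated at zero; the size of
  \<open>Omega \<omega> {..<n}\<close> gives the same sum without truncation. As truncation never
  lowers a term, it changes none.\<close>

lemma card_omega_ge:
  assumes part: "(\<Union>l<r. J l) = {..<n}" "disjoint_family_on J {..<r}"
    and rm: "r < m" and \<omega>: "\<And>j. j < n \<Longrightarrow> \<omega> j \<subseteq> {..<m}"
    and card: "card (Omega \<omega> {..<n}) = r * (m + n - r)"
    and slmf: "\<And>l. l < r \<Longrightarrow> relaxed_SLMF 1 r m \<omega> (J l)"
    and j: "j < n"
  shows "r \<le> card (\<omega> j)"
proof -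
  have fin: "finite (\<omega> j)" if "j < n" for j using \<omega>[OF that] by (rule finite_subset) simp
  have finJ: "finite (J l)" if "l < r" for l
    using part(1) that by (intro finite_subset[of "J l" "{..<n}"]) auto
  define e where "e j = max (int (card (\<omega> j)) - int r) 0" for j
  have "(\<Sum>j<n. e j) = (\<Sum>l<r. \<Sum>j\<in>J l. e j)"
    unfolding part(1)[symmetric]
    using finJ part(2) by (intro sum.UNION_disjoint) (auto simp: disjoint_family_on_def)
  also have "\<dots> = (\<Sum>l<r. int m - int r)"
  proof (rule sum.cong)
    fix l assume l: "l \<in> {..<r}"
    have "\<omega> j \<inter> {..<m} = \<omega> j" if "j \<in> J l" for j using \<omega>[of j] that part(1) l by blast
    then show "(\<Sum>j\<in>J l. e j) = int m - int r"
      using slmf[of l] l by (simp add: relaxed_SLMF_def e_def)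
  qed simp
  finally have sum_e: "(\<Sum>j<n. e j) = int r * (int m - int r)" by simp
  have "card (Omega \<omega> {..<n}) = (\<Sum>j<n. card (\<omega> j))"
    unfolding Omega_def using fin
    by (subst card_UN_disjoint) (auto simp: card_cartesian_product)
  then have "(\<Sum>j<n. int (card (\<omega> j))) = int (r * (m + n - r))"
    by (simp only: card flip: of_nat_sum)
  also have "\<dots> = int r * (int m - int r) + int n * int r"
  proof -
    have "int (m + n - r) = int m + int n - int r" using rm by simp
    then show ?thesis by (simp only: of_nat_mult) (simp add: algebra_simps)
  qed
  finally have "(\<Sum>j<n. e j - (int (card (\<omega> j)) - int r)) = 0"
    by (simp add: sum_subtractf sum_e)
  then have "e j - (int (card (\<omega> j)) - int r) = 0"
    using j by (subst (asm) sum_nonneg_eq_0_iff) (auto simp: e_def)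
  then show ?thesis by (auto simp: e_def max_def split: if_splits)
qed

text \<open>Perturb the matrix \<open>A B\<^sub>0\<close> whose column \<open>j \<in> J l\<close> is the \<open>l\<close>-th column of \<open>A\<close>: there the
  derivative of \<open>(A, B) \<mapsto> A B\<close>, restricted to \<open>\<Omega>\<close>, splits into one map for every block \<open>J l\<close>.\<close>

lemma mem_det_ideal_eq_0:
  fixes p :: "(nat \<times> nat, 'k::field) mpoly" and A :: "nat \<times> nat \<Rightarrow> 'k"
  assumes inf: "infinite (UNIV :: 'k set)"
    and part: "(\<Union>l<r. J l) = {..<n}" "disjoint_family_on J {..<r}"
    and onto: "\<And>l. l < r \<Longrightarrow> tangent_onto r \<omega> (J l) A"
    and p: "vars p \<subseteq> Omega \<omega> {..<n}" "p \<in> det_ideal (r + 1) m n"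
  shows "p = 0"
proof -
  \<comment> \<open>\<open>L j\<close> is the block containing column \<open>j\<close>, unique by
    disjointness.\<close>
  define L where "L j = (THE l. l < r \<and> j \<in> J l)" for j
  have L: "L j = l" if "l < r" "j \<in> J l" for l j
    unfolding L_def using that part(2) by (intro the_equality) (auto simp: disjoint_family_on_def)
  show ?thesis
  proof (rule poly_eq_0_if_vanishing_on_curves[OF inf, where c = "\<lambda>(i, j). A (i, L j)"])
    fix x :: "nat \<times> nat \<Rightarrow> 'k"
    have "\<forall>l. \<exists>\<delta> b. l < r \<longrightarrow> (\<forall>j\<in>J l. \<forall>i\<in>\<omega> j. (\<Sum>s<r. A (i, s) * b j s) + \<delta> i = x (i, j))"
      using onto unfolding tangent_onto_def by blast
    from choice[OF this] obtain \<delta> where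
      "\<forall>l. \<exists>b. l < r \<longrightarrow> (\<forall>j\<in>J l. \<forall>i\<in>\<omega> j. (\<Sum>s<r. A (i, s) * b j s) + \<delta> l i = x (i, j))" by blast
    from choice[OF this] obtain b where
      b: "\<And>l i j. l < r \<Longrightarrow> j \<in> J l \<Longrightarrow> i \<in> \<omega> j \<Longrightarrow> (\<Sum>s<r. A (i, s) * b l j s) + \<delta> l i = x (i, j)"
      by blast
    \<comment> \<open>\<open>y\<close> collects the products of the two perturbations. The product
      of \<open>At t\<close> and \<open>Bt t\<close> is quadratic in \<open>t\<close>, with linear
      part \<open>x\<close> on the entries that occur in \<open>p\<close>, and has inner dimension
      \<open>r\<close> for every \<open>t\<close>.\<close>
    define y where "y = (\<lambda>(i, j). \<Sum>s<r. \<delta> s i * b (L j) j s)"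
    define At where "At t = (\<lambda>(i, s). A (i, s) + t * \<delta> s i)" for t
    define Bt where "Bt t = (\<lambda>(s, j). (if s = L j then 1 else 0) + t * b (L j) j s)" for t
    have "eval_at (\<lambda>v. (case v of (i, j) \<Rightarrow> A (i, L j)) + t * x v + t\<^sup>2 * y v) p = 0" for t
    proof -
      have "eval_at (\<lambda>v. (case v of (i, j) \<Rightarrow> A (i, L j)) + t * x v + t\<^sup>2 * y v) p =
          eval_at (\<lambda>(i, j). \<Sum>s<r. At t (i, s) * Bt t (s, j)) p"
      proof (rule eval_at_cong)
        fix v assume "v \<in> vars p"
        then obtain i j where v: "v = (i, j)" "i \<in> \<omega> j" "j < n"
          using p(1) by (auto simp: Omega_def)
        then obtain l where l: "l < r" "j \<in> J l" using part(1) by blast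
        then have Lj: "L j = l" by (rule L)
        have delta: "(\<Sum>s<r. h s * (if s = l then 1 else 0)) = h l" for h :: "nat \<Rightarrow> 'k"
          using l by (simp add: if_distrib cong: if_cong)
        have "(\<Sum>s<r. At t (i, s) * Bt t (s, j)) =
            (\<Sum>s<r. A (i, s) * (if s = l then 1 else 0)) +
            t * ((\<Sum>s<r. A (i, s) * b l j s) + (\<Sum>s<r. \<delta> s i * (if s = l then 1 else 0))) +
            t\<^sup>2 * (\<Sum>s<r. \<delta> s i * b l j s)"
          unfolding At_def Bt_def Lj sum_distrib_left prod.case sum.distrib[symmetric]
          by (intro sum.cong refl) (simp add: algebra_simps power2_eq_square)
        also have "\<dots> = A (i, l) + t * x (i, j) + t\<^sup>2 * y (i, j)"
          using b[OF l v(2)] by (simp only: delta y_def Lj prod.case)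
        finally show "(case v of (i, j) \<Rightarrow> A (i, L j)) + t * x v + t\<^sup>2 * y v =
            (case v of (i, j) \<Rightarrow> \<Sum>s<r. At t (i, s) * Bt t (s, j))"
          by (simp add: v(1) Lj)
      qed
      also have "\<dots> = 0" by (rule det_ideal_vanishes[OF p(2)])
      finally show ?thesis .
    qed
    then show "\<exists>y. \<forall>t. eval_at (\<lambda>v. (case v of (i, j) \<Rightarrow> A (i, L j)) + t * x v + t\<^sup>2 * y v) p = 0"
      by blast
  qed
qed

theorem theorem1:
  fixes r m n :: nat and \<omega> :: "nat \<Rightarrow> nat set" and J :: "nat \<Rightarrow> nat set"
  assumes "infinite (UNIV :: 'k::field set)"
    and "0 < r" and "r < m" and "m \<le> n"
    and "\<And>j. j < n \<Longrightarrow> \<omega> j \<subseteq> {..<m}"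
    and "card (Omega \<omega> {..<n}) = r * (m + n - r)"
    and "(\<Union>l<r. J l) = {..<n}"
    and "disjoint_family_on J {..<r}"
    and "\<And>l. l < r \<Longrightarrow> relaxed_SLMF 1 r m \<omega> (J l)"
  shows "det_matroid_base TYPE('k) r m n (Omega \<omega> {..<n})"
proof -
  let ?\<Omega> = "Omega \<omega> {..<n}"
  have \<Omega>: "?\<Omega> \<subseteq> {..<m} \<times> {..<n}" using assms(5) by (auto simp: Omega_def)
  have J: "J l \<subseteq> {..<n}" if "l < r" for l using assms(7) that by blast
  have fin: "finite (J l)" if "l < r" for l using J[OF that] by (rule finite_subset) simp
  have fin\<omega>: "finite (\<omega> j)" if "j < n" for j using assms(5)[OF that] by (rule finite_subset) simp
  have "\<exists>C. Zariski_open C \<and> (\<exists>A. C A) \<and> (\<forall>A :: nat \<times> nat \<Rightarrow> 'k. C A \<longrightarrow> tangent_onto r \<omega> (J l) A)"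
    if l: "l < r" for l
  proof -
    have Jl: "j < n" if "j \<in> J l" for j using J[OF l] that by auto
    obtain A :: "nat \<times> nat \<Rightarrow> 'k" where "tangent_onto r \<omega> (J l) A"
      using exists_tangent_onto[OF assms(1) fin[OF l] assms(3) _ _ assms(9)[OF l]]
        assms(5)[OF Jl] card_omega_ge[OF assms(7,8,3,5,6,9) Jl] by blast
    then show ?thesis using tangent_onto_open[OF fin[OF l], of \<omega> r A] fin\<omega>[OF Jl] by blast
  qed
  then obtain C where C: "\<And>l. l < r \<Longrightarrow> Zariski_open (C l)" "\<And>l. l < r \<Longrightarrow> \<exists>A. C l A"
    "\<And>l A. l < r \<Longrightarrow> C l A \<Longrightarrow> tangent_onto r \<omega> (J l) (A :: nat \<times> nat \<Rightarrow> 'k)"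
    by metis
  \<comment> \<open>The base point has a single factor \<open>A\<close>, which must be good for all
    blocks at once.\<close>
  have "\<exists>A. \<forall>D\<in>C ` {..<r}. D A"
    using C(1,2) by (intro Zariski_open_common_point[OF assms(1)]) auto
  then obtain A where A: "\<forall>D\<in>C ` {..<r}. D A" ..
  have "tangent_onto r \<omega> (J l) A" if "l < r" for l using A that by (intro C(3)) auto
  then have indep: "det_matroid_indep TYPE('k) r m n ?\<Omega>"
    using \<Omega> mem_det_ideal_eq_0[OF assms(1,7,8)] unfolding det_matroid_indep_iff by blast
  have "\<Omega>' = ?\<Omega>" if \<Omega>': "det_matroid_indep TYPE('k) r m n \<Omega>'" "?\<Omega> \<subseteq> \<Omega>'" for \<Omega>'
  proof (rule ccontr)
    assume "\<Omega>' \<noteq> ?\<Omega>"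
    then have "?\<Omega> \<subset> \<Omega>'" using \<Omega>'(2) by blast
    moreover have V: "\<Omega>' \<subseteq> {..<m} \<times> {..<n}" using \<Omega>'(1) by (simp add: det_matroid_indep_iff)
    ultimately have "r * (m + n - r) < card \<Omega>'"
      using psubset_card_mono[of \<Omega>' ?\<Omega>] assms(6) finite_subset[OF V] by simp
    then have "\<exists>q :: (nat \<times> nat, 'k) mpoly. q \<noteq> 0 \<and> vars q \<subseteq> \<Omega>' \<and> q \<in> det_ideal (r + 1) m n"
      using assms(3,4) by (intro exists_poly_in_det_ideal[OF V]) auto
    then show False using \<Omega>'(1) by (auto simp: det_matroid_indep_iff)
  qed
  then show ?thesis using indep by (auto simp: det_matroid_base_def)
qed

end
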